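(* Let $b$ and $c$ be integers such that $\delta:=b^2-c$ is non-zero and square-free, and $\delta\not\equiv 1\pmod 4$. Let $\chi(n)=\left(\frac{4\delta}{n}\right)$ be the Kronecker symbol and $L(1,\chi)=\sum_{n\ge1}\chi(n)/n$. Then, as $N\to\infty$, $$\sum_{n=1}^N \tau(n^2+2bn+c)=\frac{2}{\zeta(2)}L(1,\chi)\, N\log N + O(N).$$
   Context: $\tau(m)$ denotes the number of positive divisors of the integer $m$; $\zeta$ is the Riemann zeta function. *)

theory Defs
  imports
    Complex_Main
    "HOL-Computational_Algebra.Squarefree"
    "HOL-Number_Theory.Number_Theory"
    "HOL-Library.Landau_Symbols"
begin

text \<open>Positive divisors of an integer of either sign; \<^term>\<open>m = 0\<close> gives the junk value 0.\<close>

definition tau :: "int \<Rightarrow> nat" where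
  "tau m = card {d::int. d > 0 \<and> d dvd m}"

definition kronecker_prime :: "int \<Rightarrow> int \<Rightarrow> int" where
  "kronecker_prime a p =
     (if p = 2 then (if even a then 0 else if a mod 8 \<in> {1, 7} then 1 else -1)
      else Legendre a p)"

text \<open>For nonzero \<^term>\<open>n\<close>, the multiset \<^term>\<open>prime_factorization n\<close> consists of the
  positive primes dividing \<^term>\<open>n\<close>, with multiplicity; the unit \<open>-1\<close> contributes the sign of
  \<^term>\<open>a\<close>, with \<open>0\<close> counted as nonnegative.\<close>

definition kronecker :: "int \<Rightarrow> int \<Rightarrow> int" where
  "kronecker a n =
     (if n = 0 then (if \<bar>a\<bar> = 1 then 1 else 0)
      else (if n < 0 \<and> a < 0 then -1 else 1)
           * (\<Prod>p\<in>#prime_factorization n. kronecker_prime a p))"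

text \<open>The Dirichlet series of the Riemann zeta function, meaningful for \<^term>\<open>s > 1\<close>.\<close>

definition zeta :: "real \<Rightarrow> real" where
  "zeta s = (\<Sum>n. 1 / real (Suc n) powr s)"

text \<open>The value \<open>L(1,\<chi>)\<close>. For nonprincipal characters the series converges only conditionally, so the
  ordered sum \<^const>\<open>suminf\<close> is used.\<close>

definition L_one :: "(nat \<Rightarrow> int) \<Rightarrow> real" where
  "L_one \<chi> = (\<Sum>n. real_of_int (\<chi> (Suc n)) / real (Suc n))"

end

theory Submission
  imports Defs "HOL-Computational_Algebra.Nth_Powers"
begin

text \<open>
  Let \<open>\<rho>(k)\<close> be the number of square roots of \<open>\<delta>\<close> modulo \<open>k\<close>, and put \<open>m = n + b\<close>, so that the
  summand is \<open>\<tau>(m\<^sup>2 - \<delta>)\<close>. Divisors of \<open>m\<^sup>2 - \<delta>\<close> pair up around \<open>\<bar>m\<bar>\<close>, so up to \<open>O(1)\<close> the summand is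
  twice the number of divisors \<open>k \<le> n\<close>. Interchanging the sums and counting \<open>n\<close> over complete residue
  systems modulo \<open>k\<close> gives \<open>2N \<Sum>\<^sub>k\<^sub>\<le>\<^sub>N \<rho>(k)/k + O(\<Sum>\<^sub>k\<^sub>\<le>\<^sub>N \<rho>(k))\<close>.

  Since \<open>4\<delta>\<close> is a fundamental discriminant, \<open>\<rho>(p\<^sup>k) = \<chi>(p)\<^sup>k + \<chi>(p)\<^sup>k\<^sup>-\<^sup>1\<close> at all primes, which says that
  \<open>\<rho>\<close> convolved with the indicator of the squares is \<open>1 * \<chi>\<close>. Reciprocity makes \<open>\<chi>\<close> periodic and
  non-principal, so its partial sums are bounded and \<open>S(N) = \<Sum>\<^sub>n\<^sub>\<le>\<^sub>N (1 * \<chi>)(n)/n = L(1,\<chi>) log N + O(1)\<close>.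
  With \<open>R(N) = \<Sum>\<^sub>n\<^sub>\<le>\<^sub>N \<rho>(n)/n\<close> one has \<open>S(N) = \<Sum>\<^sub>k R(N/k\<^sup>2)/k\<^sup>2\<close>, and \<open>0 \<le> \<rho> \<le> 1 * \<chi>\<close> bounds
  \<open>R(N) - R(N/k\<^sup>2)\<close> by \<open>O(1 + log k)\<close>; hence \<open>\<zeta>(2) R(N) = S(N) + O(1)\<close> without any Moebius inversion.
\<close>

section \<open>The Kronecker symbol\<close>

lemma kronecker_one: "kronecker a 1 = 1"
  by (simp add: kronecker_def)

lemma kronecker_mult:
  assumes "m > 0" "n > 0"
  shows "kronecker a (m * n) = kronecker a m * kronecker a n"
proof -
  have "m * n \<noteq> 0" "\<not> m * n < 0" using assms by (simp_all add: mult_less_0_iff)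
  then show ?thesis using assms by (simp add: kronecker_def prime_factorization_mult del: mult_eq_0_iff)
qed

lemma kronecker_prime_eq:
  assumes "prime p"
  shows "kronecker a p = kronecker_prime a p"
  using assms prime_gt_0_int[of p] by (simp add: kronecker_def prime_factorization_prime)

lemma kronecker_power:
  assumes "m > 0"
  shows "kronecker a (m ^ k) = kronecker a m ^ k"
  using assms by (induction k) (simp_all add: kronecker_one kronecker_mult)

text \<open>Induction on the prime factors without the cases of zero and of the unit -1.\<close>

lemma positive_int_prime_induct [consumes 1, case_names one mult]:
  fixes n :: int
  assumes "n > 0" "P 1" "\<And>p n. prime p \<Longrightarrow> n > 0 \<Longrightarrow> P n \<Longrightarrow> P (p * n)"
  shows "P n"
proof -
  have "n > 0 \<longrightarrow> P n"
  proof (induction n rule: prime_divisors_induct)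
    case (unit x)
    then show ?case using assms(2) by auto
  next
    case (factor p x)
    then show ?case using assms(3)[of p x] prime_gt_0_int[of p]
      by (simp add: zero_less_mult_iff)
  qed simp
  then show ?thesis using assms(1) by simp
qed

text \<open>Positive integers are products of primes, so a closed formula for the symbol need only
  be checked when one prime is split off. Every explicit evaluation below uses this.\<close>

lemma kronecker_eqI:
  assumes "n > 0" "g 1 = 1"
    and "\<And>p n. prime p \<Longrightarrow> n > 0 \<Longrightarrow> g (p * n) = kronecker_prime a p * g n"
  shows "kronecker a n = g n"
  using assms(1)
proof (induction n rule: positive_int_prime_induct)
  case one
  then show ?case using assms(2) by (simp add: kronecker_one)
next
  case (mult p n)
  then show ?case using assms(3)[of p n] kronecker_mult[of p n a] kronecker_prime_eq[of p a] prime_gt_0_int[of p]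
    by simp
qed

section \<open>Elementary properties of the Legendre symbol and of symbols with numerator
  \<open>4 * a\<close>\<close>

lemma Legendre_cong:
  assumes "[a = b] (mod p)"
  shows "Legendre a p = Legendre b p"
proof -
  have "[x = a] (mod p) \<longleftrightarrow> [x = b] (mod p)" for x
    using assms cong_sym cong_trans by blast
  moreover have "[a = 0] (mod p) \<longleftrightarrow> [b = 0] (mod p)"
    using assms cong_sym cong_trans by blast
  ultimately show ?thesis by (simp add: Legendre_def QuadRes_def)
qed

lemma Legendre_square:
  assumes "prime p" "\<not> p dvd a"
  shows "Legendre (a\<^sup>2) p = 1"
proof -
  have "\<not> [a\<^sup>2 = 0] (mod p)"
    using assms by (simp add: cong_0_iff prime_dvd_power_iff)
  then show ?thesis unfolding Legendre_def QuadRes_def by (metis cong_refl)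
qed

lemma odd_prime_int_gt_2:
  fixes p :: int assumes "prime p" "p \<noteq> 2" shows "p > 2"
  using assms prime_ge_2_int[of p] by simp

lemma odd_prime_int_odd:
  fixes p :: int assumes "prime p" "p \<noteq> 2" shows "odd p"
  using assms prime_odd_int odd_prime_int_gt_2 by blast

text \<open>Euler's criterion makes the two sides congruent modulo \<open>p\<close>; both lie in
  {-1, 0, 1}, so they differ by at most 2, which is less than \<open>p\<close>.\<close>

lemma Legendre_mult:
  assumes "prime p" "p \<noteq> 2"
  shows "Legendre (a * b) p = Legendre a p * Legendre b p"
proof -
  note p2 = odd_prime_int_gt_2[OF assms]
  have E: "[Legendre x p = x ^ ((nat p - 1) div 2)] (mod p)" for x
    using euler_criterion[of "nat p" x] assms p2 by (simp add: prime_nat_iff_prime)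
  have "[Legendre (a*b) p = Legendre a p * Legendre b p] (mod p)"
    using E[of "a*b"] cong_mult[OF E[of a] E[of b]]
    by (metis cong_sym cong_trans power_mult_distrib)
  then have "p dvd Legendre (a*b) p - Legendre a p * Legendre b p"
    by (simp add: cong_iff_dvd_diff)
  moreover have "\<bar>Legendre (a*b) p - Legendre a p * Legendre b p\<bar> \<le> 2"
    by (auto simp: Legendre_def)
  ultimately show ?thesis
    using p2 zdvd_imp_le[of p "\<bar>Legendre (a*b) p - Legendre a p * Legendre b p\<bar>"] by fastforce
qed

lemma Legendre_four_mult:
  assumes "prime p" "p \<noteq> 2"
  shows "Legendre (4 * a) p = Legendre a p"
proof -
  have "\<not> p dvd 2"
    using odd_prime_int_gt_2[OF assms] zdvd_not_zless by auto
  from Legendre_square[OF assms(1) this] have "Legendre 4 p = 1" by simp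
  then show ?thesis by (simp add: Legendre_mult[OF assms])
qed

lemma kronecker_four_prime:
  "prime p \<Longrightarrow> kronecker_prime (4 * a) p = (if p = 2 then 0 else Legendre a p)"
  by (simp add: kronecker_prime_def Legendre_four_mult)

text \<open>The factor 4 makes all three symbols vanish at 2, and at odd primes it is invisible.
  Hence \<open>4 * d\<close> can be split along the prime factors of \<open>d\<close> while every
  numerator keeps the form \<open>4 * a\<close>.\<close>

lemma kronecker_four_mult:
  assumes "n > 0"
  shows "kronecker (4 * (a * b)) n = kronecker (4 * a) n * kronecker (4 * b) n"
  using assms
proof (rule kronecker_eqI)
  fix p n :: int assume *: "prime p" "n > 0"
  show "kronecker (4 * a) (p * n) * kronecker (4 * b) (p * n) =
      kronecker_prime (4 * (a * b)) p * (kronecker (4 * a) n * kronecker (4 * b) n)"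
    using * prime_gt_0_int[of p]
    by (simp add: kronecker_mult kronecker_prime_eq kronecker_four_prime Legendre_mult)
qed (simp_all add: kronecker_one)

lemma kronecker_four_eq_0:
  assumes "n > 0" "prime p" "p dvd n" "p dvd 4 * d"
  shows "kronecker (4 * d) n = 0"
proof -
  obtain m where m: "n = p * m" using assms by auto
  have "m > 0" using m assms prime_gt_0_int[of p] by (simp add: zero_less_mult_iff)
  have "p = 2 \<or> p dvd d"
  proof -
    have "p dvd 2 ^ 2 \<or> p dvd d" using assms by (simp add: prime_dvd_mult_iff)
    then show ?thesis using assms(2) by (metis prime_dvd_power primes_dvd_imp_eq two_is_prime)
  qed
  then have "kronecker_prime (4 * d) p = 0"
    using assms by (auto simp: kronecker_four_prime Legendre_def cong_0_iff)
  then show ?thesis using m assms \<open>m > 0\<close> prime_gt_0_int[of p]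
    by (simp add: kronecker_mult kronecker_prime_eq)
qed

section \<open>Supplementary laws and quadratic reciprocity\<close>

lemma Legendre_minus_1:
  assumes "prime p" "p \<noteq> 2"
  shows "Legendre (-1) p = (if [p = 1] (mod 4) then 1 else -1)"
proof -
  note p2 = odd_prime_int_gt_2[OF assms] and po = odd_prime_int_odd[OF assms]
  have "[Legendre (-1) p = (-1) ^ ((nat p - 1) div 2)] (mod p)"
    using euler_criterion[of "nat p" "-1"] assms p2 by (simp add: prime_nat_iff_prime)
  then have "p dvd Legendre (-1) p - (-1) ^ ((nat p - 1) div 2)"
    by (simp add: cong_iff_dvd_diff)
  moreover have "\<bar>Legendre (-1) p - (-1) ^ ((nat p - 1) div 2)\<bar> \<le> 2"
    by (cases "even ((nat p - 1) div 2)") (auto simp: Legendre_def)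
  ultimately have "Legendre (-1) p = (-1) ^ ((nat p - 1) div 2)"
    using p2 zdvd_imp_le[of p "\<bar>Legendre (-1) p - (-1) ^ ((nat p - 1) div 2)\<bar>"] by fastforce
  moreover have "even ((nat p - 1) div 2) \<longleftrightarrow> [p = 1] (mod 4)"
  proof -
    define h where "h = (p - 1) div 2"
    have ph: "p = 2 * h + 1" using po h_def by presburger
    have "(nat p - 1) div 2 = nat h" using ph p2 by simp
    moreover have "even (nat h) \<longleftrightarrow> even h" using ph p2 by (subst even_nat_iff) auto
    moreover have "even h \<longleftrightarrow> p mod 4 = 1" using ph by presburger
    ultimately show ?thesis by (simp add: cong_def)
  qed
  ultimately show ?thesis by simp
qed

text \<open>By Gauss's lemma the sign is governed by how many of 2, 4, ..., \<open>2 * h\<close>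
  exceed \<open>h = (p - 1) div 2\<close>; these come from \<open>x > h div 2\<close>.\<close>

lemma Legendre_2:
  assumes "prime p" "p \<noteq> 2"
  shows "Legendre 2 p = (if p mod 8 = 1 \<or> p mod 8 = 7 then 1 else -1)"
proof -
  note p2 = odd_prime_int_gt_2[OF assms] and po = odd_prime_int_odd[OF assms]
  define h where "h = (p - 1) div 2"
  have ph: "p = 2 * h + 1" using po h_def by presburger
  have "prime (nat p)" "\<not> p dvd 2"
    using assms p2 zdvd_not_zless[of 2 p] by (simp_all add: prime_nat_iff_prime)
  then interpret G: GAUSS "nat p" 2
    using p2 by unfold_locales (simp_all add: cong_0_iff)
  \<comment> \<open>No reduction modulo \<open>p\<close> takes place, because
    \<open>2 * h < p\<close>.\<close>
  have "G.C = (\<lambda>x. x * 2) ` {0<..h}"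
  proof -
    have "(\<lambda>x. (x * 2) mod p) ` {0<..h} = (\<lambda>x. x * 2) ` {0<..h}"
      using p2 ph by (intro image_cong) auto
    then show ?thesis
      unfolding G.C_def G.B_def G.A_def using p2 by (simp add: image_image h_def)
  qed
  then have "G.E = (\<lambda>x. x * 2) ` {h div 2<..h}"
    unfolding G.E_def using p2 by (auto simp: h_def)
  then have "card G.E = card {h div 2<..h}"
    by (simp add: card_image inj_on_def)
  also have "\<dots> = nat (h - h div 2)" by simp
  finally have "Legendre 2 p = (-1) ^ nat (h - h div 2)"
    using G.gauss_lemma p2 by simp
  moreover have "even (h - h div 2) \<longleftrightarrow> p mod 8 = 1 \<or> p mod 8 = 7"
    using ph by presburger
  then have "even (nat (h - h div 2)) \<longleftrightarrow> p mod 8 = 1 \<or> p mod 8 = 7"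
    using p2 ph by (subst even_nat_iff) auto
  ultimately show ?thesis by simp
qed

text \<open>An equivalence of truth values encodes a product of signs: this is multiplicativity of
  the non-principal character modulo 4. The next lemma does the same for the character modulo 8 that
  is 1 on the classes 1 and 7.\<close>

lemma odd_mult_mod_4:
  fixes p n :: int
  assumes "odd p" "odd n"
  shows "(p * n) mod 4 = 1 \<longleftrightarrow> (p mod 4 = 1 \<longleftrightarrow> n mod 4 = 1)"
proof -
  have "p mod 4 = 1 \<or> p mod 4 = 3" "n mod 4 = 1 \<or> n mod 4 = 3" using assms by presburger+
  then show ?thesis by (subst mod_mult_eq[symmetric]) (elim disjE; simp)
qed

lemma odd_mult_mod_8:
  fixes p n :: int
  assumes "odd p" "odd n"
  shows "((p * n) mod 8 = 1 \<or> (p * n) mod 8 = 7) \<longleftrightarrow>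
    ((p mod 8 = 1 \<or> p mod 8 = 7) \<longleftrightarrow> (n mod 8 = 1 \<or> n mod 8 = 7))"
proof -
  have "p mod 8 = 1 \<or> p mod 8 = 3 \<or> p mod 8 = 5 \<or> p mod 8 = 7"
    "n mod 8 = 1 \<or> n mod 8 = 3 \<or> n mod 8 = 5 \<or> n mod 8 = 7" using assms by presburger+
  then show ?thesis by (subst (1 2) mod_mult_eq[symmetric]) (elim disjE; simp)
qed

lemma kronecker_minus_4:
  assumes "n > 0"
  shows "kronecker (-4) n = (if even n then 0 else if n mod 4 = 1 then 1 else -1)"
  using assms
proof (rule kronecker_eqI)
  fix p n :: int assume *: "prime p" "n > 0"
  have "kronecker_prime (-4) p = (if even p then 0 else if p mod 4 = 1 then 1 else -1)"
  proof (cases "p = 2")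
    case False
    then show ?thesis using * odd_prime_int_odd[of p] kronecker_four_prime[of p "-1"] Legendre_minus_1[of p]
      by (simp add: cong_def)
  qed (use * kronecker_four_prime[of p "-1"] in simp)
  then show "(if even (p * n) then 0 else if (p * n) mod 4 = 1 then 1 else - 1) =
       kronecker_prime (-4) p * (if even n then 0 else if n mod 4 = 1 then 1 else - 1)"
    using odd_mult_mod_4[of p n] by simp
qed simp

lemma kronecker_8:
  assumes "n > 0"
  shows "kronecker 8 n = (if even n then 0 else if n mod 8 = 1 \<or> n mod 8 = 7 then 1 else -1)"
  using assms
proof (rule kronecker_eqI)
  fix p n :: int assume *: "prime p" "n > 0"
  have "kronecker_prime 8 p = (if even p then 0 else if p mod 8 = 1 \<or> p mod 8 = 7 then 1 else -1)"
  proof (cases "p = 2")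
    case False
    then show ?thesis using * odd_prime_int_odd[of p] kronecker_four_prime[of p 2] Legendre_2[of p]
      by simp
  qed (use * kronecker_four_prime[of p 2] in simp)
  then show "(if even (p * n) then 0 else if (p * n) mod 8 = 1 \<or> (p * n) mod 8 = 7 then 1 else - 1) =
       kronecker_prime 8 p * (if even n then 0 else if n mod 8 = 1 \<or> n mod 8 = 7 then 1 else - 1)"
    using odd_mult_mod_8[of p n] by simp
qed simp

text \<open>Reciprocity moves \<open>n\<close> into the numerator, where the dependence on
  \<open>n\<close> is visibly periodic. The extra sign is the reciprocity sign, -1 exactly when both
  numbers are 3 modulo 4.\<close>

lemma kronecker_four_odd_prime:
  assumes "prime q" "q \<noteq> 2" "n > 0"
  shows "kronecker (4 * q) n =
    (if even n then 0 else Legendre n q * (if q mod 4 = 3 \<and> n mod 4 = 3 then -1 else 1))"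
  using assms(3)
proof (rule kronecker_eqI)
  note q2 = odd_prime_int_gt_2[OF assms(1,2)] and qo = odd_prime_int_odd[OF assms(1,2)]
  have "\<not> q dvd 1" using q2 zdvd_not_zless by auto
  then have "Legendre 1 q = 1" using Legendre_square[OF assms(1), of 1] by simp
  then show "(if even (1::int) then 0 else Legendre 1 q * (if q mod 4 = 3 \<and> (1::int) mod 4 = 3 then -1 else 1)) = 1"
    by simp
  fix p n :: int assume *: "prime p" "n > 0"
  have k: "kronecker_prime (4 * q) p = (if even p then 0 else Legendre p q * (if q mod 4 = 3 \<and> p mod 4 = 3 then -1 else 1))"
  proof (cases "p = 2")
    case False
    note p2 = odd_prime_int_gt_2[OF *(1) False] and po = odd_prime_int_odd[OF *(1) False]
    have "Legendre q p = Legendre p q * (if q mod 4 = 3 \<and> p mod 4 = 3 then -1 else 1)"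
    proof (cases "p = q")
      case True
      then show ?thesis by (simp add: Legendre_def cong_0_iff)
    next
      case False
      have "Legendre p q * Legendre q p = (-1) ^ nat ((p - 1) div 2 * ((q - 1) div 2))"
        using Quadratic_Reciprocity_int[of p q] assms * p2 q2 False by simp
      moreover have "even (nat ((p - 1) div 2 * ((q - 1) div 2))) \<longleftrightarrow> \<not> (q mod 4 = 3 \<and> p mod 4 = 3)"
      proof -
        have "even ((p - 1) div 2) \<longleftrightarrow> \<not> p mod 4 = 3" "even ((q - 1) div 2) \<longleftrightarrow> \<not> q mod 4 = 3"
          using po qo by presburger+
        then show ?thesis using p2 q2 by (auto simp: even_nat_iff)
      qed
      ultimately have "Legendre p q * Legendre q p = (if q mod 4 = 3 \<and> p mod 4 = 3 then -1 else 1)"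
        by simp
      \<comment> \<open>The product is a sign, so neither symbol is 0 and each is its own
        inverse.\<close>
      moreover have "Legendre p q \<in> {-1, 0, 1}" "Legendre q p \<in> {-1, 0, 1}" by (auto simp: Legendre_def)
      ultimately show ?thesis by (auto split: if_splits)
    qed
    then show ?thesis using po * False by (simp add: kronecker_four_prime)
  qed (use * in \<open>simp add: kronecker_four_prime\<close>)
  show "(if even (p * n) then 0 else Legendre (p * n) q * (if q mod 4 = 3 \<and> (p * n) mod 4 = 3 then -1 else 1)) =
       kronecker_prime (4 * q) p * (if even n then 0 else Legendre n q * (if q mod 4 = 3 \<and> n mod 4 = 3 then -1 else 1))"
  proof (cases "odd p \<and> odd n")
    case True
    then have "p mod 4 = 1 \<or> p mod 4 = 3" "n mod 4 = 1 \<or> n mod 4 = 3" by presburger+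
    then have "(p * n) mod 4 = 3 \<longleftrightarrow> (p mod 4 = 3 \<longleftrightarrow> n mod 4 \<noteq> 3)"
      by (subst mod_mult_eq[symmetric]) (elim disjE; simp)
    then show ?thesis using True by (simp add: k Legendre_mult[OF assms(1,2)])
  qed (auto simp: k)
qed

text \<open>The period is not minimal; the factor 8 lets the induction over the prime factors of \<open>d\<close> treat
  the supplementary laws for \<open>-1\<close> and \<open>2\<close> uniformly.\<close>

lemma kronecker_periodic:
  assumes "d \<noteq> 0" "m > 0" "n > 0" "[m = n] (mod 8 * d)"
  shows "kronecker (4 * d) m = kronecker (4 * d) n"
proof -
  have par: "(even m \<longleftrightarrow> even n) \<and> m mod 4 = n mod 4" if "[m = n] (mod 8)" for m n :: int
  proof -
    have "[m = n] (mod 2)" "[m = n] (mod 4)" by (rule cong_dvd_modulus[OF that], simp)+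
    then show ?thesis using cong_dvd_iff[of m n 2] by (simp add: cong_def)
  qed
  \<comment> \<open>The case \<open>d = 1\<close> is the principal character modulo 2.\<close>
  have one: "kronecker 4 m = kronecker 4 n" if "m > 0" "n > 0" "[m = n] (mod 8)" for m n
  proof -
    have "kronecker 4 k = (if even k then 0 else 1)" if "k > 0" for k
      using that
    proof (rule kronecker_eqI)
      fix p n :: int assume *: "prime p" "n > 0"
      have "kronecker_prime 4 p = (if even p then 0 else 1)"
      proof (cases "p = 2")
        case False
        have "\<not> p dvd 1" using * by auto
        then show ?thesis using False * odd_prime_int_odd[of p] Legendre_square[of p 1] kronecker_four_prime[of p 1]
          by simp
      qed (use * kronecker_four_prime[of p 1] in simp)
      then show "(if even (p * n) then 0 else 1) = kronecker_prime 4 p * (if even n then 0 else 1)"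
        by simp
    qed simp
    moreover have "even m \<longleftrightarrow> even n" using par[OF that(3)] by blast
    ultimately show ?thesis using that(1,2) by simp
  qed
  have minus: "kronecker (-4) m = kronecker (-4) n" if "m > 0" "n > 0" "[m = n] (mod 8)" for m n
  proof -
    show ?thesis using that(1,2) par[OF that(3)] by (simp add: kronecker_minus_4)
  qed
  have two: "kronecker 8 m = kronecker 8 n" if "m > 0" "n > 0" "[m = n] (mod 8)" for m n
  proof -
    show ?thesis using that(1,2) par[OF that(3)] that(3) by (simp add: kronecker_8 cong_def)
  qed
  have odd_prime: "kronecker (4 * q) m = kronecker (4 * q) n"
    if "prime q" "q \<noteq> 2" "m > 0" "n > 0" "[m = n] (mod 8)" "[m = n] (mod q)" for q m n
  proof -
    show ?thesis using that(1-4) par[OF that(5)] Legendre_cong[OF that(6)]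
      by (simp add: kronecker_four_odd_prime)
  qed
  have "d \<noteq> 0 \<longrightarrow> [m = n] (mod 8 * d) \<longrightarrow> kronecker (4 * d) m = kronecker (4 * d) n"
  proof (induction d rule: prime_divisors_induct)
    case (unit x)
    then have "x = 1 \<or> x = -1" by auto
    then show ?case using one[OF assms(2,3)] minus[OF assms(2,3)] by (auto simp: cong_iff_dvd_diff)
  next
    case (factor q x)
    show ?case
    proof (intro impI)
      assume "q * x \<noteq> 0" and c: "[m = n] (mod 8 * (q * x))"
      \<comment> \<open>The congruence modulo \<open>8 * (q * x)\<close> restricts to
        \<open>8 * x\<close> for the cofactor, and to 8 and \<open>q\<close> for the new
        prime.\<close>
      have "kronecker (4 * x) m = kronecker (4 * x) n"
        using factor.IH \<open>q * x \<noteq> 0\<close> c cong_dvd_modulus[OF c, of "8 * x"] by simp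
      moreover have "kronecker (4 * q) m = kronecker (4 * q) n"
      proof (cases "q = 2")
        case True
        then show ?thesis using two[OF assms(2,3)] cong_dvd_modulus[OF c, of 8] by simp
      next
        case False
        then show ?thesis
          using odd_prime[OF factor.hyps False assms(2,3)] cong_dvd_modulus[OF c, of 8]
            cong_dvd_modulus[OF c, of q] by simp
      qed
      ultimately show "kronecker (4 * (q * x)) m = kronecker (4 * (q * x)) n"
        using assms by (simp only: kronecker_four_mult)
    qed
  qed simp
  then show ?thesis using assms by simp
qed

text \<open>Squaring identifies \<open>1\<close> and \<open>q - 1\<close>, so it is not onto the residues.\<close>

lemma exists_quadratic_nonresidue:
  assumes "prime q" "q \<noteq> 2"
  shows "\<exists>u. \<not> QuadRes q u"
proof (rule ccontr)
  note q2 = odd_prime_int_gt_2[OF assms]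
  assume "\<not> (\<exists>u. \<not> QuadRes q u)"
  then have "\<exists>y. [y\<^sup>2 = u] (mod q)" for u by (simp add: QuadRes_def)
  then have "{0..<q} \<subseteq> (\<lambda>x. x\<^sup>2 mod q) ` {0..<q}"
  proof (intro subsetI)
    fix u assume u: "u \<in> {0..<q}" and "\<And>u. \<exists>y. [y\<^sup>2 = u] (mod q)"
    then obtain y where "[y\<^sup>2 = u] (mod q)" by blast
    then have "(y mod q)\<^sup>2 mod q = u" using u by (simp add: cong_def power_mod)
    then show "u \<in> (\<lambda>x. x\<^sup>2 mod q) ` {0..<q}" using q2 by (intro image_eqI[of _ _ "y mod q"]) auto
  qed
  moreover have "(\<lambda>x. x\<^sup>2 mod q) ` {0..<q} \<subseteq> {0..<q}" using q2 by auto
  ultimately have "inj_on (\<lambda>x. x\<^sup>2 mod q) {0..<q}"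
    by (intro eq_card_imp_inj_on) auto
  moreover have "(q - 1)\<^sup>2 mod q = 1\<^sup>2 mod q"
    by (simp add: mod_eq_dvd_iff power2_eq_square algebra_simps)
  ultimately have "q - 1 = 1" 
    using q2 inj_onD[of "\<lambda>x. x\<^sup>2 mod q" "{0..<q}" "q - 1" 1] by simp
  then show False using assms by simp
qed

section \<open>Non-principality and cancellation over a period\<close>

text \<open>If an odd prime \<open>q\<close> divides \<open>d = q * e\<close>, then \<open>q\<close>
  is prime to \<open>8 * e\<close> by squarefreeness. The Chinese remainder theorem gives an
  argument that is a non-residue modulo \<open>q\<close> and 1 modulo \<open>8 * e\<close>, so the
  factors at \<open>q\<close> and \<open>e\<close> are -1 and 1. Otherwise \<open>d\<close> is -1, 2
  or -2, checked by hand.\<close>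

lemma kronecker_nonprincipal:
  assumes "squarefree d" "d \<noteq> 1"
  shows "\<exists>n>0. kronecker (4 * d) n = -1"
proof (cases "\<exists>q. prime q \<and> q \<noteq> 2 \<and> q dvd d")
  case True
  then obtain q e where q: "prime q" "q \<noteq> 2" "d = q * e" by auto
  note q2 = odd_prime_int_gt_2[OF q(1,2)]
  have "d \<noteq> 0" using assms(1) by auto
  then have "e \<noteq> 0" using q by auto
  have "\<not> q dvd e"
  proof
    assume "q dvd e"
    then have "q\<^sup>2 dvd d" using q by (simp add: power2_eq_square)
    then show False using assms(1) q unfolding squarefree_def by (meson not_prime_unit)
  qed
  moreover have "\<not> q dvd 2 ^ 3" using q by (metis prime_dvd_power primes_dvd_imp_eq two_is_prime)
  ultimately have "\<not> q dvd 8 * e" using q by (simp add: prime_dvd_mult_iff)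
  then have "coprime q (8 * e)" using q by (intro prime_imp_coprime)
  obtain u where u: "\<not> QuadRes q u" using exists_quadratic_nonresidue q by blast
  obtain n where n: "[n = u] (mod q)" "[n = 1] (mod 8 * e)"
    using binary_chinese_remainder_int[OF \<open>coprime q (8 * e)\<close>] by blast
  \<comment> \<open>Adding the modulus to the remainder gives a positive representative, as the
    explicit formulas require.\<close>
  define N where "N = n mod (q * (8 * \<bar>e\<bar>)) + q * (8 * \<bar>e\<bar>)"
  have "N > 0" unfolding N_def using q2 \<open>e \<noteq> 0\<close>
    by (intro add_nonneg_pos pos_mod_sign mult_pos_pos) auto
  have Nn: "[N = n] (mod q * (8 * \<bar>e\<bar>))" by (simp add: N_def cong_def)
  have "[N = u] (mod q)" by (rule cong_trans[OF cong_dvd_modulus[OF Nn] n(1)]) simp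
  have "[N = 1] (mod 8 * e)" by (rule cong_trans[OF cong_dvd_modulus[OF Nn] n(2)]) simp
  \<comment> \<open>This makes \<open>N\<close> odd and 1 modulo 4, so the reciprocity sign is
    1.\<close>
  then have "[N = 1] (mod 8)" by (rule cong_dvd_modulus) simp
  have "Legendre N q = -1"
  proof -
    have "\<not> QuadRes q u" by fact
    moreover have "QuadRes q u" if "[u = 0] (mod q)"
      using that unfolding QuadRes_def by (intro exI[of _ 0]) (simp add: cong_sym)
    ultimately have "Legendre u q = -1" by (auto simp: Legendre_def)
    then show ?thesis using Legendre_cong[OF \<open>[N = u] (mod q)\<close>] by simp
  qed
  moreover have "odd N" "N mod 4 = 1"
    using cong_dvd_modulus[OF \<open>[N = 1] (mod 8)\<close>, of 2] cong_dvd_modulus[OF \<open>[N = 1] (mod 8)\<close>, of 4]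
    by (simp_all add: cong_def odd_iff_mod_2_eq_one)
  ultimately have "kronecker (4 * q) N = -1"
    using q \<open>N > 0\<close> by (simp add: kronecker_four_odd_prime)
  moreover have "kronecker (4 * e) N = 1"
    using kronecker_periodic[OF \<open>e \<noteq> 0\<close> \<open>N > 0\<close> _ \<open>[N = 1] (mod 8 * e)\<close>] by (simp add: kronecker_one)
  ultimately show ?thesis using \<open>N > 0\<close> q by (intro exI[of _ N]) (simp add: kronecker_four_mult)
next
  case False
  have "d \<noteq> 0" using assms(1) by auto
  have "\<bar>d\<bar> = 1 \<or> \<bar>d\<bar> = 2"
  proof (rule ccontr)
    assume ne: "\<not> ?thesis"
    then obtain p where p: "prime p" "p dvd d"
      using prime_factor_int[of d] by auto
    then have "p = 2" using False by auto
    then obtain e where e: "d = 2 * e" using p by auto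
    then have "\<bar>e\<bar> \<noteq> 1" using ne by auto
    then obtain p' where p': "prime p'" "p' dvd e" using prime_factor_int[of e] by auto
    then have "p' = 2" using False e by auto
    then have "2\<^sup>2 dvd d" using e p' by auto
    then show False using assms(1) unfolding squarefree_def by (auto dest: spec[of _ 2])
  qed
  then consider "d = -1" | "d = 2" | "d = -2" using assms(2) by linarith
  then show ?thesis
  proof cases
    case 1
    then show ?thesis by (intro exI[of _ 3]) (simp add: kronecker_minus_4)
  next
    case 2
    then show ?thesis by (intro exI[of _ 3]) (simp add: kronecker_8)
  next
    case 3
    have "kronecker (4 * (2 * -1)) 5 = -1"
      by (subst kronecker_four_mult) (simp_all add: kronecker_8 kronecker_minus_4)
    then show ?thesis using 3 by (intro exI[of _ 5]) simp
  qed
qed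

text \<open>Multiplication by an \<open>a\<close> with \<chi>(a) = -1 permutes the residues modulo
  the period and negates the sum over a period, which is therefore 0. Only an incomplete period
  remains.\<close>

lemma kronecker_partial_sums_bounded:
  assumes "squarefree d" "d \<noteq> 1"
  shows "\<exists>C\<ge>0. \<forall>N. \<bar>\<Sum>n<N. kronecker (4 * d) (int n)\<bar> \<le> C"
proof -
  define \<chi> where "\<chi> n = kronecker (4 * d) (int n)" for n
  define M where "M = nat (8 * \<bar>d\<bar>)"
  have "d \<noteq> 0" using assms(1) by auto
  then have "M > 0" by (simp add: M_def)
  have intM: "int M = 8 * \<bar>d\<bar>" by (simp add: M_def)
  \<comment> \<open>The symbol at 0 is 1 for numerators 1 and -1 only, so here it is 0.\<close>
  have "\<bar>4 * d\<bar> \<noteq> 1" by presburger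
  then have chi0: "\<chi> 0 = 0" by (simp add: \<chi>_def kronecker_def)
  have even0: "\<chi> n = 0" if "even n" for n
    using that kronecker_four_eq_0[of "int n" 2 d] chi0 by (cases "n = 0") (auto simp: \<chi>_def)
  have per: "\<chi> m = \<chi> n" if "[m = n] (mod M)" for m n
  proof (cases "m = 0 \<or> n = 0")
    case True
    \<comment> \<open>\<open>kronecker_periodic\<close> needs positive arguments. If one argument is
      0, both are even, and both values vanish.\<close>
    have "even M" using intM by presburger
    then have "[m = n] (mod 2)" by (rule cong_dvd_modulus_nat[OF that])
    then have "even m \<longleftrightarrow> even n" by (rule cong_dvd_iff)
    then show ?thesis using True even0 by auto
  next
    case False
    have "[int m = int n] (mod 8 * d)"
      using that cong_int_iff[of m n M] intM
      by (cases "d \<ge> 0") (auto simp: cong_iff_dvd_diff)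
    then show ?thesis unfolding \<chi>_def using False \<open>d \<noteq> 0\<close> by (intro kronecker_periodic) auto
  qed
  obtain a where a: "a > 0" "kronecker (4 * d) a = -1"
    using kronecker_nonprincipal[OF assms] by blast
  \<comment> \<open>A common prime factor would divide \<open>4 * d\<close> and force the value 0
    instead of -1.\<close>
  have "coprime a (int M)"
  proof (rule ccontr)
    assume "\<not> coprime a (int M)"
    then have "\<bar>gcd a (int M)\<bar> \<noteq> 1" by (simp add: coprime_iff_gcd_eq_1)
    then obtain p where p: "prime p" "p dvd gcd a (int M)" using prime_factor_int by blast
    then have "p dvd 8 * d" using intM by (cases "d \<ge> 0") auto
    then have "p dvd 2 \<or> p dvd 4 * d" using p prime_dvd_mult_iff[of p 2 "4 * d"] by simp
    then have "p dvd 4 * d" by (auto intro: dvd_trans)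
    then show False using kronecker_four_eq_0[of a p d] p a by simp
  qed
  define A where "A = nat a"
  have A: "A > 0" "\<chi> A = -1" using a by (simp_all add: A_def \<chi>_def)
  have "coprime A M" using \<open>coprime a (int M)\<close> a by (simp add: A_def flip: coprime_int_iff)
  have Am: "\<chi> (A * n) = - \<chi> n" for n
    using A kronecker_mult[of "int A" "int n" "4 * d"] chi0 by (cases "n = 0") (auto simp: \<chi>_def)
  have inj: "inj_on (\<lambda>n. A * n mod M) {..<M}"
  proof (rule inj_onI)
    fix x y assume *: "x \<in> {..<M}" "y \<in> {..<M}" "A * x mod M = A * y mod M"
    then have "[A * x = A * y] (mod M)" by (simp add: cong_def)
    then have "[x = y] (mod M)" using \<open>coprime A M\<close> by (simp add: cong_mult_lcancel_nat)
    then show "x = y" using * by (simp add: cong_def)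
  qed
  then have "(\<lambda>n. A * n mod M) ` {..<M} = {..<M}"
    using \<open>M > 0\<close> by (intro endo_inj_surj) auto
  then have "(\<Sum>n<M. \<chi> n) = (\<Sum>n<M. \<chi> (A * n mod M))"
    using sum.reindex[OF inj, of \<chi>] by simp
  also have "\<dots> = (\<Sum>n<M. \<chi> (A * n))" by (intro sum.cong per) (simp_all add: cong_def)
  also have "\<dots> = - (\<Sum>n<M. \<chi> n)" by (simp add: Am sum_negf)
  finally have sum0: "(\<Sum>n<M. \<chi> n) = 0" by simp
  have red: "(\<Sum>n<N. \<chi> n) = (\<Sum>n<N mod M. \<chi> n)" for N
  proof (induction N rule: less_induct)
    case (less N)
    show ?case
    proof (cases "N < M")
      case False
      have "(\<Sum>n<N. \<chi> n) = (\<Sum>n<M. \<chi> n) + (\<Sum>n\<in>{M..<N}. \<chi> n)"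
        using False by (subst sum.union_disjoint[symmetric]) (auto intro!: sum.cong)
      also have "(\<Sum>n\<in>{M..<N}. \<chi> n) = (\<Sum>n<N - M. \<chi> (n + M))"
        using False by (intro sum.reindex_bij_witness[of _ "\<lambda>n. n + M" "\<lambda>n. n - M"]) auto
      also have "\<dots> = (\<Sum>n<N - M. \<chi> n)" by (intro sum.cong per) (simp_all add: cong_def)
      also have "\<dots> = (\<Sum>n<(N - M) mod M. \<chi> n)" using less[of "N - M"] False \<open>M > 0\<close> by simp
      finally show ?thesis using sum0 False by (simp add: le_mod_geq)
    qed simp
  qed
  show ?thesis
  proof (intro exI conjI allI)
    show "0 \<le> (\<Sum>n<M. \<bar>\<chi> n\<bar>)" by (intro sum_nonneg) simp
    fix N
    have "\<bar>\<Sum>n<N. \<chi> n\<bar> \<le> (\<Sum>n<N mod M. \<bar>\<chi> n\<bar>)" unfolding red[of N] by (rule sum_abs)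
    also have "\<dots> \<le> (\<Sum>n<M. \<bar>\<chi> n\<bar>)"
      using \<open>M > 0\<close> by (intro sum_mono2) (auto intro: less_trans)
    finally show "\<bar>\<Sum>n<N. kronecker (4 * d) (int n)\<bar> \<le> (\<Sum>n<M. \<bar>\<chi> n\<bar>)" by (simp add: \<chi>_def)
  qed
qed

section \<open>Dirichlet convolution\<close>

text \<open>Only meaningful for positive arguments: every number divides 0.\<close>

definition dirichlet_conv :: "(nat \<Rightarrow> 'a) \<Rightarrow> (nat \<Rightarrow> 'a) \<Rightarrow> nat \<Rightarrow> 'a::comm_semiring_1" where
  "dirichlet_conv f g n = (\<Sum>d | d dvd n. f d * g (n div d))"

definition multiplicative :: "(nat \<Rightarrow> 'a::comm_semiring_1) \<Rightarrow> bool" where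
  "multiplicative f \<longleftrightarrow> f 1 = 1 \<and> (\<forall>a b. a > 0 \<longrightarrow> b > 0 \<longrightarrow> coprime a b \<longrightarrow> f (a * b) = f a * f b)"

lemma multiplicativeD:
  "multiplicative f \<Longrightarrow> a > 0 \<Longrightarrow> b > 0 \<Longrightarrow> coprime a b \<Longrightarrow> f (a * b) = f a * f b"
  by (simp add: multiplicative_def)

text \<open>For coprime \<open>a\<close> and \<open>b\<close> the divisors of \<open>a * b\<close>
  are the products \<open>x * y\<close> of divisors of each, and \<open>d\<close> is taken apart
  again by \<open>gcd d a\<close> and \<open>gcd d b\<close>.\<close>

lemma multiplicative_dirichlet_conv:
  assumes f: "multiplicative f" and g: "multiplicative g"
  shows "multiplicative (dirichlet_conv f g)"
  unfolding multiplicative_def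
proof (intro conjI allI impI)
  show "dirichlet_conv f g 1 = 1" using f g by (simp add: dirichlet_conv_def multiplicative_def)
next
  fix a b :: nat
  assume a: "a > 0" and b: "b > 0" and cop: "coprime a b"
  have gcd_part: "gcd (x * y) a = x" if "x dvd a" "y dvd b" "coprime a b" for x y a b :: nat
  proof -
    have "coprime y a" using that coprime_divisors coprime_commute dvd_refl by metis
    then have "gcd (x * y) a = gcd x a" by (simp add: gcd_mult_right_right_cancel gcd.commute coprime_commute)
    then show ?thesis using that by (simp add: gcd_nat.absorb1)
  qed
  have "dirichlet_conv f g a * dirichlet_conv f g b =
      (\<Sum>(x, y)\<in>{x. x dvd a} \<times> {y. y dvd b}. (f x * g (a div x)) * (f y * g (b div y)))"
    unfolding dirichlet_conv_def sum_product sum.cartesian_product ..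
  also have "\<dots> = (\<Sum>(x, y)\<in>{x. x dvd a} \<times> {y. y dvd b}. f (x * y) * g (a * b div (x * y)))"
  proof (intro sum.cong refl, clarify)
    fix x y assume x: "x dvd a" and y: "y dvd b"
    have pos: "x > 0" "y > 0" "a div x > 0" "b div y > 0"
      using x y a b by (auto simp: dvd_pos_nat div_greater_zero_iff dvd_imp_le)
    have "coprime x y" using coprime_divisors[OF x y cop] .
    moreover have "coprime (a div x) (b div y)"
    proof (rule coprime_divisors[OF _ _ cop])
      show "a div x dvd a" "b div y dvd b" using x y by (metis dvd_mult_div_cancel dvd_triv_right)+
    qed
    ultimately have "f (x * y) = f x * f y" "g ((a div x) * (b div y)) = g (a div x) * g (b div y)"
      using pos multiplicativeD[OF f] multiplicativeD[OF g] by blast+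
    moreover have "a * b div (x * y) = (a div x) * (b div y)" using div_mult_div_if_dvd[OF x y] by simp
    ultimately show "f x * g (a div x) * (f y * g (b div y)) = f (x * y) * g (a * b div (x * y))"
      by (simp add: ac_simps)
  qed
  also have "\<dots> = dirichlet_conv f g (a * b)"
    unfolding dirichlet_conv_def
  proof (rule sum.reindex_bij_witness[of _ "\<lambda>d. (gcd d a, gcd d b)" "\<lambda>(x, y). x * y"])
    fix z assume "z \<in> {x. x dvd a} \<times> {y. y dvd b}"
    then obtain x y where z: "z = (x, y)" "x dvd a" "y dvd b" by auto
    then show "(gcd (case z of (x, y) \<Rightarrow> x * y) a, gcd (case z of (x, y) \<Rightarrow> x * y) b) = z"
      using gcd_part[of x a y b] gcd_part[of y b x a] cop by (simp add: mult.commute coprime_commute)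
    show "(case z of (x, y) \<Rightarrow> x * y) \<in> {d. d dvd a * b}"
      using z by (simp add: mult_dvd_mono)
  next
    fix d assume "d \<in> {d. d dvd a * b}"
    then have "d dvd a * b" by simp
    then obtain x y where "d = x * y" "x dvd a" "y dvd b" using division_decomp by blast
    then show "(case (gcd d a, gcd d b) of (x, y) \<Rightarrow> x * y) = d"
      using gcd_part[of x a y b] gcd_part[of y b x a] cop by (simp add: mult.commute coprime_commute)
  qed auto
  finally show "dirichlet_conv f g (a * b) = dirichlet_conv f g a * dirichlet_conv f g b" ..
qed

lemma dirichlet_conv_commute:
  assumes "n > 0"
  shows "dirichlet_conv f g n = dirichlet_conv g f n"
  unfolding dirichlet_conv_def
  using assms
  by (intro sum.reindex_bij_witness[of _ "\<lambda>d. n div d" "\<lambda>d. n div d"])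
    (auto simp: div_div_eq_right div_dvd_iff_mult mult.commute elim!: dvdE)

text \<open>Splitting off the full power of one prime leaves a smaller cofactor coprime to
  it.\<close>

lemma multiplicative_eqI:
  assumes f: "multiplicative f" and g: "multiplicative g"
    and "\<And>p k. prime p \<Longrightarrow> f (p ^ k) = g (p ^ k)" "n > 0"
  shows "f n = g n"
  using assms(4)
proof (induction n rule: less_induct)
  case (less n)
  show ?case
  proof (cases "n = 1")
    case True
    then show ?thesis using f g by (simp add: multiplicative_def)
  next
    case False
    then obtain p where p: "prime p" "p dvd n" using prime_factor_nat by blast
    have ne: "n \<noteq> 0" "\<not> is_unit p" using less.prems p by auto
    obtain m where m: "n = p ^ multiplicity p n * m" "\<not> p dvd m"
      using multiplicity_decompose'[OF ne] by blast
    have k: "multiplicity p n > 0" using p ne by (simp add: prime_multiplicity_gt_zero_iff)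
    have "m > 0" using m less.prems by (metis mult_0_right neq0_conv)
    have "p ^ multiplicity p n > 1" using k prime_gt_1_nat[OF p(1)] by (metis one_less_power)
    then have "m < p ^ multiplicity p n * m" using \<open>m > 0\<close> by simp
    then have "m < n" using m(1) by metis
    have "coprime (p ^ multiplicity p n) m" using m p by (simp add: prime_imp_coprime)
    then show ?thesis
      using multiplicativeD[OF f, of "p ^ multiplicity p n" m] multiplicativeD[OF g, of "p ^ multiplicity p n" m]
        less.IH[OF \<open>m < n\<close> \<open>m > 0\<close>] assms(3)[OF p(1)] prime_gt_0_nat[OF p(1)] \<open>m > 0\<close> m(1) by (metis zero_less_power)
  qed
qed

lemma dirichlet_conv_prime_power:
  assumes "prime p"
  shows "dirichlet_conv f g (p ^ k) = (\<Sum>i\<le>k. f (p ^ i) * g (p ^ (k - i)))"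
proof -
  have p1: "p > 1" using prime_gt_1_nat[OF assms] .
  have "{d. d dvd p ^ k} = (\<lambda>i. p ^ i) ` {..k}"
    using divides_primepow_nat[OF assms] by (auto simp: le_imp_power_dvd)
  moreover have "inj_on (\<lambda>i. p ^ i) {..k}" using p1 by (auto simp: inj_on_def)
  moreover have "p ^ k div p ^ i = p ^ (k - i)" if "i \<le> k" for i
    using that p1 by (simp add: power_diff)
  ultimately show ?thesis by (simp add: dirichlet_conv_def sum.reindex)
qed

text \<open>The coefficients of the Dirichlet series \<open>\<zeta>(2s)\<close>; at s = 1 it
  produces the factor \<open>zeta 2\<close>.\<close>

definition square_ind :: "nat \<Rightarrow> int" where
  "square_ind n = of_bool (is_square n)"

lemma multiplicative_square_ind: "multiplicative square_ind"
  by (auto simp: multiplicative_def square_ind_def is_nth_power_mult_coprime_nat_iff)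

lemma square_ind_prime_power:
  assumes "prime p"
  shows "square_ind (p ^ k) = of_bool (even k)"
proof -
  have "is_square (p ^ k) \<longleftrightarrow> even k"
    using assms by (simp add: is_nth_power_prime_power_nat_iff)
  then show ?thesis by (simp add: square_ind_def)
qed

section \<open>Square roots modulo \<open>k\<close>\<close>

definition roots_mod :: "int \<Rightarrow> int \<Rightarrow> int set" where
  "roots_mod d k = {x\<in>{0..<k}. k dvd x\<^sup>2 - d}"

text \<open>Integer-valued, since its local values are expressed through a symbol that may be
  -1.\<close>

definition rho :: "int \<Rightarrow> nat \<Rightarrow> int" where
  "rho d k = int (card (roots_mod d (int k)))"

lemma mod_in_roots_mod_iff:
  assumes "k > 0"
  shows "x mod k \<in> roots_mod d k \<longleftrightarrow> k dvd x\<^sup>2 - d"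
proof -
  have "[(x mod k)\<^sup>2 - d = x\<^sup>2 - d] (mod k)"
    by (intro cong_diff cong_pow cong_refl) (simp add: cong_def)
  then have "k dvd (x mod k)\<^sup>2 - d \<longleftrightarrow> k dvd x\<^sup>2 - d" by (rule cong_dvd_iff)
  then show ?thesis using assms by (simp add: roots_mod_def)
qed

text \<open>Chinese remainder theorem: a root modulo \<open>a * b\<close> is a pair of roots modulo
  \<open>a\<close> and modulo \<open>b\<close>.\<close>

lemma multiplicative_rho: "multiplicative (rho d)"
  unfolding multiplicative_def
proof (intro conjI allI impI)
  have "roots_mod d 1 = {0}" by (auto simp: roots_mod_def)
  then show "rho d 1 = 1" by (simp add: rho_def)
next
  fix a b :: nat
  assume a: "a > 0" and b: "b > 0" and "coprime a b"
  then have cop: "coprime (int a) (int b)" by simp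
  have "bij_betw (\<lambda>x. (x mod int a, x mod int b)) (roots_mod d (int (a * b)))
      (roots_mod d (int a) \<times> roots_mod d (int b))"
    unfolding bij_betw_def
  proof
    show "inj_on (\<lambda>x. (x mod int a, x mod int b)) (roots_mod d (int (a * b)))"
    proof (rule inj_onI)
      fix x y assume *: "x \<in> roots_mod d (int (a * b))" "y \<in> roots_mod d (int (a * b))"
        "(x mod int a, x mod int b) = (y mod int a, y mod int b)"
      then have "[x = y] (mod int a * int b)"
        using cop by (intro coprime_cong_mult) (auto simp: cong_def)
      then show "x = y" using * by (simp add: cong_def roots_mod_def)
    qed
    show "(\<lambda>x. (x mod int a, x mod int b)) ` roots_mod d (int (a * b)) =
        roots_mod d (int a) \<times> roots_mod d (int b)"
    proof (intro equalityI subsetI)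
      fix z assume "z \<in> (\<lambda>x. (x mod int a, x mod int b)) ` roots_mod d (int (a * b))"
      then obtain x where "z = (x mod int a, x mod int b)" "int a * int b dvd x\<^sup>2 - d"
        by (auto simp: roots_mod_def)
      then show "z \<in> roots_mod d (int a) \<times> roots_mod d (int b)"
        using a b by (auto simp: mod_in_roots_mod_iff elim: dvd_mult_left dvd_mult_right)
    next
      fix z assume "z \<in> roots_mod d (int a) \<times> roots_mod d (int b)"
      then obtain u v where z: "z = (u, v)" "u \<in> roots_mod d (int a)" "v \<in> roots_mod d (int b)" by auto
      obtain x where x: "[x = u] (mod int a)" "[x = v] (mod int b)"
        using binary_chinese_remainder_int[OF cop] by blast
      then have xm: "x mod int a = u" "x mod int b = v" using z by (auto simp: cong_def roots_mod_def)
      then have "int a dvd x\<^sup>2 - d" "int b dvd x\<^sup>2 - d"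
        using z a b mod_in_roots_mod_iff[of "int a" x d] mod_in_roots_mod_iff[of "int b" x d] by simp_all
      then have "int (a * b) dvd x\<^sup>2 - d" using cop by (simp add: divides_mult)
      then have "x mod int (a * b) \<in> roots_mod d (int (a * b))" using a b by (subst mod_in_roots_mod_iff) auto
      then show "z \<in> (\<lambda>x. (x mod int a, x mod int b)) ` roots_mod d (int (a * b))"
        using z xm by (intro image_eqI[of _ _ "x mod int (a * b)"]) (simp_all add: mod_mod_cancel)
    qed
  qed
  then show "rho d (a * b) = rho d a * rho d b"
    using bij_betw_same_card by (fastforce simp: rho_def card_cartesian_product)
qed

section \<open>Square roots modulo prime powers\<close>

text \<open>Hensel lifting: since \<open>p\<close> is odd and prime to \<open>d\<close>, the
  derivative \<open>2 * x\<close> is a unit at every root \<open>x\<close>, so each root modulo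
  \<open>p ^ k\<close> has exactly one lift.\<close>

lemma rho_prime_power_hensel:
  assumes "prime p" "p \<noteq> 2" "\<not> int p dvd d" "k > 0"
  shows "rho d (p ^ Suc k) = rho d (p ^ k)"
proof -
  define P where "P = int p"
  have P: "prime P" "P > 2" "\<not> P dvd d" "P ^ k > 0"
    using assms odd_prime_int_gt_2[of P] by (auto simp: P_def)
  have root_cop: "\<not> P dvd 2 * x" if "P dvd x\<^sup>2 - d" for x
  proof
    assume "P dvd 2 * x"
    then have "P dvd x" using P zdvd_not_zless[of 2 P] by (simp add: prime_dvd_mult_iff)
    then have "P dvd x\<^sup>2" by (simp add: power2_eq_square)
    then have "P dvd d" using that by (metis dvd_diff_commute dvd_diff_right_iff)
    then show False using P by simp
  qed
  have dvdP: "P dvd P ^ k" using \<open>k > 0\<close> by (simp add: dvd_power)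
  have "bij_betw (\<lambda>x. x mod P ^ k) (roots_mod d (P ^ Suc k)) (roots_mod d (P ^ k))"
    unfolding bij_betw_def
  proof
    show "inj_on (\<lambda>x. x mod P ^ k) (roots_mod d (P ^ Suc k))"
    proof (rule inj_onI)
      fix x y assume x: "x \<in> roots_mod d (P ^ Suc k)" and y: "y \<in> roots_mod d (P ^ Suc k)"
        and "x mod P ^ k = y mod P ^ k"
      then have "P ^ k dvd x - y" by (simp add: mod_eq_dvd_iff)
      then have "P dvd x - y" using dvdP dvd_trans by blast
      have dx: "P ^ Suc k dvd x\<^sup>2 - d" and "P ^ Suc k dvd y\<^sup>2 - d" using x y by (auto simp: roots_mod_def)
      then have "P ^ Suc k dvd (x\<^sup>2 - d) - (y\<^sup>2 - d)" by (rule dvd_diff)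
      then have 1: "P ^ Suc k dvd (x - y) * (x + y)" by (simp add: power2_eq_square algebra_simps)
      have "P dvd x\<^sup>2 - d" using dx by (metis dvd_triv_left dvd_trans power_Suc)
      \<comment> \<open>Since \<open>x\<close> and \<open>y\<close> agree modulo \<open>P\<close>,
        their sum is congruent to the unit \<open>2 * x\<close>; hence all of
        \<open>P ^ Suc k\<close> divides \<open>x - y\<close>.\<close>
      have "\<not> P dvd x + y"
      proof
        assume "P dvd x + y"
        then have "P dvd (x - y) + (x + y)" using \<open>P dvd x - y\<close> by (rule dvd_add[rotated])
        then show False using root_cop[OF \<open>P dvd x\<^sup>2 - d\<close>] by simp
      qed
      then have "coprime (P ^ Suc k) (x + y)" using P(1) by (simp add: prime_imp_coprime)
      then have "P ^ Suc k dvd x - y" using 1 by (simp only: coprime_dvd_mult_left_iff)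
      then show "x = y" using x y by (simp add: roots_mod_def flip: mod_eq_dvd_iff)
    qed
    show "(\<lambda>x. x mod P ^ k) ` roots_mod d (P ^ Suc k) = roots_mod d (P ^ k)"
    proof (intro equalityI subsetI)
      fix z assume "z \<in> (\<lambda>x. x mod P ^ k) ` roots_mod d (P ^ Suc k)"
      then obtain x where "z = x mod P ^ k" "P ^ Suc k dvd x\<^sup>2 - d" by (auto simp: roots_mod_def)
      moreover have "P ^ k dvd P ^ Suc k" by simp
      ultimately show "z \<in> roots_mod d (P ^ k)" using P(4) dvd_trans mod_in_roots_mod_iff by metis
    next
      fix x assume x: "x \<in> roots_mod d (P ^ k)"
      then obtain s where s: "x\<^sup>2 - d = P ^ k * s" by (auto simp: roots_mod_def)
      then have "P dvd x\<^sup>2 - d" using dvdP by simp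
      then have "coprime (2 * x) P" using root_cop P(1) prime_imp_coprime coprime_commute by metis
      \<comment> \<open>The Newton correction: \<open>t\<close> makes the linear term of
        \<open>(x + t * P ^ k)\<^sup>2 - d\<close> cancel modulo \<open>P ^ Suc k\<close>.\<close>
      then obtain t where t: "[2 * x * t = - s] (mod P)" using cong_solve_coprime_int[of "2 * x" P]
        by (metis cong_scalar_right mult.assoc mult.commute mult_1 )
      define y where "y = x + t * P ^ k"
      have "y\<^sup>2 - d = P ^ k * (s + 2 * x * t) + t\<^sup>2 * (P ^ k * P ^ k)"
        using s by (simp add: y_def power2_eq_square algebra_simps)
      moreover have "P dvd s + 2 * x * t" using t by (simp add: cong_iff_dvd_diff algebra_simps)
      then have "P ^ Suc k dvd P ^ k * (s + 2 * x * t)" by (simp add: mult.commute mult_dvd_mono)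
      \<comment> \<open>The quadratic term carries \<open>P\<close> to the power 2k, which is at
        least k + 1 because \<open>k > 0\<close>.\<close>
      moreover have "P ^ Suc k dvd t\<^sup>2 * (P ^ k * P ^ k)"
        using dvdP by (simp add: mult_dvd_mono dvd_mult)
      ultimately have "P ^ Suc k dvd y\<^sup>2 - d" by simp
      then have "y mod P ^ Suc k \<in> roots_mod d (P ^ Suc k)" using P by (simp add: mod_in_roots_mod_iff)
      moreover have "y mod P ^ Suc k mod P ^ k = x"
      proof -
        have "y mod P ^ Suc k mod P ^ k = y mod P ^ k" by (rule mod_mod_cancel) simp
        also have "\<dots> = x mod P ^ k" by (simp add: y_def)
        also have "\<dots> = x" using x by (simp add: roots_mod_def)
        finally show ?thesis .
      qed
      ultimately show "x \<in> (\<lambda>x. x mod P ^ k) ` roots_mod d (P ^ Suc k)" by (metis image_eqI)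
    qed
  qed
  then show ?thesis using bij_betw_same_card by (fastforce simp: rho_def P_def)
qed

text \<open>The roots are 0 alone if \<open>p\<close> divides \<open>d\<close>, none for a
  non-residue, and otherwise \<open>x\<close> and \<open>p - x\<close>, distinct because
  \<open>p\<close> is odd.\<close>

lemma rho_prime:
  assumes "prime p" "p \<noteq> 2"
  shows "rho d p = 1 + Legendre d (int p)"
proof -
  define P where "P = int p"
  have P: "prime P" "P > 2" using assms odd_prime_int_gt_2[of P] by (auto simp: P_def)
  consider "P dvd d" | "\<not> P dvd d" "\<not> QuadRes P d" | "\<not> P dvd d" "QuadRes P d" by blast
  then have "int (card (roots_mod d P)) = 1 + Legendre d P"
  proof cases
    case 1
    have "roots_mod d P = {0}"
    proof (intro equalityI subsetI)
      fix x assume x: "x \<in> roots_mod d P"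
      then have "P dvd x\<^sup>2 - d" by (simp add: roots_mod_def)
      then have "P dvd x\<^sup>2" using 1 dvd_diff_right_iff by (metis dvd_diff_left_iff)
      then have "P dvd x" using P prime_dvd_power by blast
      then have "\<not> 0 < x" using x zdvd_not_zless[of x P] by (auto simp: roots_mod_def)
      then show "x \<in> {0}" using x by (simp add: roots_mod_def)
    qed (use 1 P in \<open>auto simp: roots_mod_def\<close>)
    then show ?thesis using 1 by (simp add: Legendre_def cong_0_iff)
  next
    case 2
    have "roots_mod d P = {}" using 2 by (auto simp: roots_mod_def QuadRes_def cong_iff_dvd_diff)
    then show ?thesis using 2 by (simp add: Legendre_def cong_0_iff)
  next
    case 3
    then obtain y where "P dvd y\<^sup>2 - d" by (auto simp: QuadRes_def cong_iff_dvd_diff)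
    define x where "x = y mod P"
    have x: "x \<in> roots_mod d P" using \<open>P dvd y\<^sup>2 - d\<close> P by (simp add: x_def mod_in_roots_mod_iff)
    then have xb: "0 \<le> x" "x < P" "P dvd x\<^sup>2 - d" by (auto simp: roots_mod_def)
    have "x \<noteq> 0" using xb(3) 3 by auto
    have "x \<noteq> P - x"
    proof
      assume "x = P - x"
      then have "even P" by presburger
      then show False using P prime_odd_int by blast
    qed
    have "roots_mod d P = {x, P - x}"
    proof (intro equalityI subsetI)
      fix z assume z: "z \<in> roots_mod d P"
      then have zb: "0 \<le> z" "z < P" "P dvd z\<^sup>2 - d" by (auto simp: roots_mod_def)
      have "P dvd (z\<^sup>2 - d) - (x\<^sup>2 - d)" using zb(3) xb(3) by (rule dvd_diff)
      then have "P dvd (z - x) * (z + x)" by (simp add: power2_eq_square algebra_simps)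
      then have "P dvd z - x \<or> P dvd z + x" using P(1) prime_dvd_mult_iff by blast
      then show "z \<in> {x, P - x}"
      proof
        assume "P dvd z - x"
        then have "z mod P = x mod P" by (simp add: mod_eq_dvd_iff)
        then show ?thesis using zb xb by simp
      next
        assume "P dvd z + x"
        then have "P dvd (z + x) - P" by simp
        then have "P dvd z - (P - x)" by (simp add: algebra_simps)
        then have "z mod P = (P - x) mod P" by (simp only: mod_eq_dvd_iff)
        moreover have "(P - x) mod P = P - x" using xb \<open>x \<noteq> 0\<close> by (intro mod_pos_pos_trivial) auto
        moreover have "z mod P = z" using zb by simp
        ultimately show ?thesis by simp
      qed
    next
      have "(P - x)\<^sup>2 - d = P * (P - 2 * x) + (x\<^sup>2 - d)" by (simp add: power2_eq_square algebra_simps)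
      then have "P dvd (P - x)\<^sup>2 - d" using xb(3) by (metis dvd_add dvd_triv_left)
      then have "P - x \<in> roots_mod d P" using xb \<open>x \<noteq> 0\<close> by (simp add: roots_mod_def)
      then show "z \<in> roots_mod d P" if "z \<in> {x, P - x}" for z using that x by auto
    qed
    then show ?thesis using 3 \<open>x \<noteq> P - x\<close> by (simp add: Legendre_def cong_0_iff)
  qed
  then show ?thesis by (simp add: rho_def P_def)
qed

text \<open>This is where \<open>4 * d\<close> being a fundamental discriminant enters. Squares are
  0 or 1 modulo 4, but \<open>d\<close> is neither. For an odd \<open>p\<close> dividing
  \<open>d\<close>, a root would be divisible by \<open>p\<close>, so that \<open>p\<^sup>2\<close>
  would divide \<open>d\<close>.\<close>

lemma rho_prime_power_ramified:
  assumes "squarefree d" "\<not> [d = 1] (mod 4)" "prime p" "int p dvd 4 * d" "k \<ge> 2"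
  shows "rho d (p ^ k) = 0"
proof -
  have "False" if "int p ^ k dvd x\<^sup>2 - d" for x
  proof -
    have dv: "(int p)\<^sup>2 dvd x\<^sup>2 - d" using that \<open>k \<ge> 2\<close> by (meson le_imp_power_dvd dvd_trans)
    have n4: "\<not> 4 dvd d" using assms(1) unfolding squarefree_def by (auto dest: spec[of _ 2])
    show False
    proof (cases "p = 2")
      case True
      have "x\<^sup>2 mod 4 = 0 \<or> x\<^sup>2 mod 4 = 1"
      proof (cases "even x")
        case False
        then obtain y where "x = 2 * y + 1" by (auto elim: oddE)
        then have "x\<^sup>2 = 4 * (y\<^sup>2 + y) + 1" by (simp add: power2_eq_square algebra_simps)
        then show ?thesis by presburger
      qed (auto elim!: evenE simp: power_mult_distrib)
      moreover have "x\<^sup>2 mod 4 = d mod 4" using dv True by (simp add: mod_eq_dvd_iff)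
      ultimately show False using n4 assms(2) by (auto simp: cong_def dvd_eq_mod_eq_0)
    next
      case False
      have P: "prime (int p)" using assms by simp
      have "int p dvd 2 ^ 2 \<or> int p dvd d" using assms(4) P by (simp add: prime_dvd_mult_iff)
      moreover have "\<not> int p dvd 2 ^ 2"
        using False P by (metis prime_dvd_power primes_dvd_imp_eq two_is_prime of_nat_numeral of_nat_eq_iff)
      ultimately have "int p dvd d" by simp
      moreover have "int p dvd x\<^sup>2 - d" using dv by (metis dvd_triv_left dvd_trans power2_eq_square)
      ultimately have "int p dvd x\<^sup>2" by (metis dvd_diff_left_iff)
      then have "int p dvd x" using P prime_dvd_power by blast
      then have "(int p)\<^sup>2 dvd x\<^sup>2" by simp
      then have "(int p)\<^sup>2 dvd d" using dv by (metis dvd_diff_right_iff)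
      then have "is_unit (int p)" using assms(1) unfolding squarefree_def by blast
      then show False using P not_prime_unit by blast
    qed
  qed
  then have "roots_mod d (int p ^ k) = {}" by (auto simp: roots_mod_def)
  then show ?thesis by (simp add: rho_def)
qed

lemma rho_2: "rho d 2 = 1"
proof -
  have "roots_mod d 2 = {d mod 2}"
  proof (intro equalityI subsetI)
    fix x assume "x \<in> roots_mod d 2"
    then have "x = 0 \<or> x = 1" "even (x\<^sup>2 - d)" by (auto simp: roots_mod_def)
    then show "x \<in> {d mod 2}" by auto presburger
  next
    fix x assume "x \<in> {d mod 2}"
    then show "x \<in> roots_mod d 2" by (cases "even d") (auto simp: roots_mod_def odd_iff_mod_2_eq_one)
  qed
  then show ?thesis by (simp add: rho_def)
qed

text \<open>For \<open>c\<close> equal to 1 or -1 the right side is \<open>1 + c\<close> for every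
  \<open>k\<close>, which lifting preserves. For \<open>c = 0\<close> it is 1 at
  \<open>k = 0\<close>, where \<open>0 ^ 0 = 1\<close>, and 0 afterwards, which is the ramified
  case.\<close>

lemma rho_prime_power:
  assumes "squarefree d" "\<not> [d = 1] (mod 4)" "prime p"
  defines "c \<equiv> kronecker (4 * d) (int p)"
  shows "rho d (p ^ Suc k) = c ^ k + c ^ Suc k"
proof -
  have P: "prime (int p)" using assms by simp
  have c: "c = (if p = 2 then 0 else Legendre d (int p))"
    unfolding c_def using kronecker_prime_eq[OF P] kronecker_four_prime[OF P] by simp
  have base: "rho d p = 1 + c"
    using rho_prime[of p d] rho_2[of d] c assms by (cases "p = 2") auto
  show ?thesis
  proof (cases "p = 2 \<or> int p dvd d")
    case True
    then have "c = 0" using c by (auto simp: Legendre_def cong_0_iff)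
    moreover have "int p dvd 4 * d" using True by auto
    ultimately show ?thesis using base rho_prime_power_ramified[OF assms(1-3), of "Suc k"]
      by (cases k) auto
  next
    case False
    then have "c = 1 \<or> c = -1" using c by (auto simp: Legendre_def cong_0_iff)
    have "rho d (p ^ Suc k) = 1 + c"
    proof (induction k)
      case (Suc k)
      then show ?case using rho_prime_power_hensel[of p d "Suc k"] assms False by simp
    qed (simp add: base)
    then show ?thesis using \<open>c = 1 \<or> c = -1\<close> by auto
  qed
qed

lemma multiplicative_kronecker: "multiplicative (\<lambda>n. kronecker a (int n))"
  by (simp add: multiplicative_def kronecker_one kronecker_mult)

text \<open>In terms of Dirichlet series, that of \<open>rho d\<close> times
  \<open>\<zeta>(2s)\<close> is \<open>\<zeta>(s) L(s,\<chi>)\<close>. By multiplicativity only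
  prime powers matter, where the right side is a geometric sum in \<open>c\<close>.\<close>

lemma rho_conv_square_ind:
  assumes "squarefree d" "\<not> [d = 1] (mod 4)" "n > 0"
  shows "dirichlet_conv (rho d) square_ind n = dirichlet_conv (\<lambda>_. 1) (\<lambda>n. kronecker (4 * d) (int n)) n"
proof (rule multiplicative_eqI)
  show "multiplicative (dirichlet_conv (rho d) square_ind)"
    by (intro multiplicative_dirichlet_conv multiplicative_rho multiplicative_square_ind)
  show "multiplicative (dirichlet_conv (\<lambda>_. 1) (\<lambda>n. kronecker (4 * d) (int n)))"
    by (intro multiplicative_dirichlet_conv multiplicative_kronecker) (simp add: multiplicative_def)
  fix p k :: nat assume p: "prime p"
  define c where "c = kronecker (4 * d) (int p)"
  have r: "rho d (p ^ Suc k) = c ^ k + c ^ Suc k" for k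
    using rho_prime_power[OF assms(1,2) p] by (simp add: c_def)
  have r0: "rho d 1 = 1" using multiplicative_rho by (auto simp: multiplicative_def)
  have R: "dirichlet_conv (\<lambda>_. 1) (\<lambda>n. kronecker (4 * d) (int n)) (p ^ k) = (\<Sum>i\<le>k. c ^ i)" for k
  proof -
    have "kronecker (4 * d) (int (p ^ j)) = c ^ j" for j
      using prime_gt_0_nat[OF p] by (simp add: kronecker_power c_def)
    then have "dirichlet_conv (\<lambda>_. 1) (\<lambda>n. kronecker (4 * d) (int n)) (p ^ k) = (\<Sum>i\<le>k. c ^ (k - i))"
      by (simp add: dirichlet_conv_prime_power[OF p])
    then show ?thesis using sum.atLeastAtMost_rev[of "\<lambda>i. c ^ i" 0 k] by (simp add: atMost_atLeast0)
  qed
  define F where "F k = dirichlet_conv (rho d) square_ind (p ^ k)" for k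
  have F: "F k = (\<Sum>i\<le>k. rho d (p ^ i) * of_bool (even (k - i)))" for k
    by (simp add: F_def dirichlet_conv_prime_power[OF p] square_ind_prime_power[OF p])
  \<comment> \<open>The square indicator sees only the parity of an exponent. Two steps therefore
    add one value of \<open>rho\<close>, which is the next two powers of \<open>c\<close>.\<close>
  have F2: "F (Suc (Suc k)) = F k + rho d (p ^ Suc (Suc k))" for k
  proof -
    have "(\<Sum>i\<le>k. rho d (p ^ i) * of_bool (even (Suc (Suc k) - i))) = F k"
      unfolding F by (intro sum.cong refl) (simp add: Suc_diff_le)
    then show ?thesis by (subst F) simp
  qed
  have "F k = (\<Sum>i\<le>k. c ^ i)"
  proof (induction k rule: induct_nat_012)
    case 0
    then show ?case using r0 by (simp add: F)
  next
    case 1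
    then show ?case using r0 r[of 0] by (simp add: F)
  next
    case (ge2 k)
    then show ?case using F2[of k] r[of "Suc k"] by simp
  qed
  then show "dirichlet_conv (rho d) square_ind (p ^ k) =
      dirichlet_conv (\<lambda>_. 1) (\<lambda>n. kronecker (4 * d) (int n)) (p ^ k)"
    unfolding F_def R .
qed (use assms in simp)

section \<open>Mean values\<close>

text \<open>Both sides run over the lattice points \<open>(d, e)\<close> with
  \<open>d * e \<le> N\<close>.\<close>

lemma sum_divisors_swap:
  fixes h :: "nat \<Rightarrow> nat \<Rightarrow> 'a::comm_monoid_add"
  shows "(\<Sum>n=1..N. \<Sum>d | d dvd n. h d (n div d)) = (\<Sum>d=1..N. \<Sum>e=1..N div d. h d e)"
proof -
  have "(\<Sum>n=1..N. \<Sum>d | d dvd n. h d (n div d)) =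
      (\<Sum>(n, d)\<in>(SIGMA n:{1..N}. {d. d dvd n}). h d (n div d))"
    by (rule sum.Sigma) auto
  also have "\<dots> = (\<Sum>(d, e)\<in>(SIGMA d:{1..N}. {1..N div d}). h d e)"
  proof (rule sum.reindex_bij_witness[of _ "\<lambda>(d, e). (d * e, d)" "\<lambda>(n, d). (d, n div d)"])
    fix z assume "z \<in> (SIGMA n:{1..N}. {d. d dvd n})"
    then obtain d e where z: "z = (d * e, d)" "1 \<le> d * e" "d * e \<le> N" by (auto elim!: dvdE)
    then have "d > 0" "e > 0" by auto
    then show "(case z of (n, d) \<Rightarrow> (d, n div d)) \<in> (SIGMA d:{1..N}. {1..N div d})"
      using z by (auto simp: less_eq_div_iff_mult_less_eq mult.commute intro: order_trans[rotated])
  next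
    fix z assume "z \<in> (SIGMA d:{1..N}. {1..N div d})"
    then show "(case z of (d, e) \<Rightarrow> (d * e, d)) \<in> (SIGMA n:{1..N}. {d. d dvd n})"
      by (auto simp: less_eq_div_iff_mult_less_eq mult.commute)
  qed auto
  also have "\<dots> = (\<Sum>d=1..N. \<Sum>e=1..N div d. h d e)"
    by (rule sum.Sigma[symmetric]) auto
  finally show ?thesis .
qed

lemma sum_dirichlet_conv:
  "(\<Sum>n=1..N. dirichlet_conv f g n) = (\<Sum>d=1..N. f d * (\<Sum>e=1..N div d. g e))"
  using sum_divisors_swap[of "\<lambda>d e. f d * g e" N] by (simp add: dirichlet_conv_def sum_distrib_left)

lemma dirichlet_conv_div:
  fixes f g :: "nat \<Rightarrow> real"
  assumes "n > 0"
  shows "dirichlet_conv f g n / real n = dirichlet_conv (\<lambda>d. f d / real d) (\<lambda>e. g e / real e) n"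
  unfolding dirichlet_conv_def sum_divide_distrib
proof (intro sum.cong refl)
  fix d assume "d \<in> {d. d dvd n}"
  then obtain e where "n = d * e" by auto
  then show "f d * g (n div d) / real n = f d / real d * (g (n div d) / real (n div d))"
    using assms by simp
qed

lemma sum_dirichlet_conv_div:
  fixes f g :: "nat \<Rightarrow> real"
  shows "(\<Sum>n=1..N. dirichlet_conv f g n / real n) =
    (\<Sum>d=1..N. f d / real d * (\<Sum>e=1..N div d. g e / real e))"
  unfolding sum_dirichlet_conv[symmetric] by (intro sum.cong refl dirichlet_conv_div) simp

section \<open>Harmonic sums, the series L(1,\<chi>), and the mean value of the convolution of 1 and
  \<chi>\<close>

lemma ln_harmonic_bound:
  assumes "N > 0"
  shows "\<bar>(\<Sum>m=1..N. 1 / real m) - ln (real N)\<bar> \<le> 1"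
proof -
  \<comment> \<open>The lower bound by \<open>ln (real N + 1)\<close> is the one that reproduces
    itself in the induction; like the upper bound, its step comes from ln x \<le> x - 1.\<close>
  have "ln (real N) \<le> (\<Sum>m=1..N. 1 / real m) \<and> (\<Sum>m=1..N. 1 / real m) \<le> 1 + ln (real N) \<and>
      ln (real N + 1) \<le> (\<Sum>m=1..N. 1 / real m)"
    using assms
  proof (induction N rule: nat_induct_non_zero)
    case 1
    show ?case using ln_add_one_self_le_self[of 1] by simp
  next
    case (Suc n)
    have "ln (real n / real (Suc n)) \<le> real n / real (Suc n) - 1"
      using Suc.hyps by (intro ln_le_minus_one) simp
    then have 1: "ln (real n) + 1 / real (Suc n) \<le> ln (real (Suc n))"
      using Suc.hyps by (simp add: ln_div field_simps)
    have "ln ((real n + 2) / real (Suc n)) \<le> (real n + 2) / real (Suc n) - 1"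
      by (intro ln_le_minus_one) simp
    then have 2: "ln (real n + 2) \<le> ln (real (Suc n)) + 1 / real (Suc n)"
      by (simp add: ln_div field_simps)
    have "ln (real n + 1) \<le> (\<Sum>m=1..n. 1 / real m) + 1 / real (Suc n)"
      using Suc.IH by (intro add_increasing2) simp_all
    then show ?case using 1 2 Suc.IH by (simp add: add.commute)
  qed
  then show ?thesis by linarith
qed

text \<open>Abel summation against the bounded partial sums. The estimate is uniform in the upper
  limit, so it also proves convergence, and \<open>suminf\<close> is the true limit.\<close>

lemma dirichlet_series_at_1_tail:
  fixes \<chi> :: "nat \<Rightarrow> real"
  assumes A: "\<And>N. \<bar>\<Sum>n=1..N. \<chi> n\<bar> \<le> C"
  shows "\<bar>(\<Sum>n=1..N. \<chi> n / real n) - (\<Sum>n. \<chi> (Suc n) / real (Suc n))\<bar> \<le> 2 * C / real (Suc N)"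
proof -
  define A where "A N = (\<Sum>n=1..N. \<chi> n)" for N
  define s where "s N = (\<Sum>n=1..N. \<chi> n / real n)" for N
  have AC: "\<bar>A N\<bar> \<le> C" for N using assms by (simp add: A_def)
  have parts: "\<bar>(s M - s N) - (A M / real (Suc M) - A N / real (Suc N))\<bar> \<le> C * (1 / real (Suc N) - 1 / real (Suc M))"
    if "N \<le> M" for N M
    using that
  proof (induction M rule: dec_induct)
    case (step M)
    have "s (Suc M) = s M + (A (Suc M) - A M) / real (Suc M)" by (simp add: s_def A_def)
    then have "(s (Suc M) - s N) - (A (Suc M) / real (Suc (Suc M)) - A N / real (Suc N)) =
        ((s M - s N) - (A M / real (Suc M) - A N / real (Suc N)))
          + A (Suc M) * (1 / real (Suc M) - 1 / real (Suc (Suc M)))"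
      by (simp add: diff_divide_distrib right_diff_distrib del: of_nat_Suc)
    moreover have "\<bar>A (Suc M) * (1 / real (Suc M) - 1 / real (Suc (Suc M)))\<bar>
        \<le> C * (1 / real (Suc M) - 1 / real (Suc (Suc M)))"
      unfolding abs_mult using AC[of "Suc M"] by (intro mult_mono) (auto simp: frac_le)
    ultimately show ?case using step.IH by (simp add: algebra_simps)
  qed simp
  \<comment> \<open>The boundary term at \<open>M\<close> costs at most
    \<open>C / real (Suc M)\<close>, which cancels against the telescoped majorant.\<close>
  have diff: "\<bar>s M - s N\<bar> \<le> 2 * C / real (Suc N)" if "N \<le> M" for N M
  proof -
    have "\<bar>A M / real (Suc M)\<bar> \<le> C / real (Suc M)" "\<bar>A N / real (Suc N)\<bar> \<le> C / real (Suc N)"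
      using AC by (simp_all add: divide_right_mono)
    moreover have "C * (1 / real (Suc N) - 1 / real (Suc M)) = C / real (Suc N) - C / real (Suc M)"
      by (simp add: right_diff_distrib)
    moreover have "2 * C / real (Suc N) = C / real (Suc N) + C / real (Suc N)" by simp
    ultimately show ?thesis using parts[OF that] by linarith
  qed
  have "C \<ge> 0" using AC[of 0] by linarith
  have lim0: "(\<lambda>N. 2 * C / real (Suc N)) \<longlonglongrightarrow> 0"
    using tendsto_mult_right_zero[OF LIMSEQ_inverse_real_of_nat, of "2 * C"] by (simp add: field_simps)
  have "Cauchy s"
  proof (rule CauchyI')
    fix e :: real assume "e > 0"
    then obtain N where N: "2 * C / real (Suc N) < e"
      using order_tendstoD(2)[OF lim0, of e] by (auto simp: eventually_sequentially)
    show "\<exists>M. \<forall>m\<ge>M. \<forall>n>m. dist (s m) (s n) < e"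
    proof (intro exI allI impI)
      fix m n assume "m \<ge> N" "n > m"
      then have "\<bar>s n - s m\<bar> \<le> 2 * C / real (Suc m)" by (intro diff) simp
      also have "\<dots> \<le> 2 * C / real (Suc N)" using \<open>m \<ge> N\<close> \<open>C \<ge> 0\<close> by (intro divide_left_mono) auto
      finally show "dist (s m) (s n) < e" using N by (simp add: dist_real_def abs_minus_commute)
    qed
  qed
  then obtain l where l: "s \<longlonglongrightarrow> l" using Cauchy_convergent convergent_def by blast
  have "s = (\<lambda>N. \<Sum>n<N. \<chi> (Suc n) / real (Suc n))"
    unfolding s_def by (simp add: sum.atLeast1_atMost_eq)
  then have "(\<lambda>n. \<chi> (Suc n) / real (Suc n)) sums l" using l unfolding sums_def by simp
  then have L: "(\<Sum>n. \<chi> (Suc n) / real (Suc n)) = l" by (simp add: sums_iff)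
  have "\<bar>l - s N\<bar> \<le> 2 * C / real (Suc N)"
  proof (rule tendsto_upperbound)
    show "(\<lambda>M. \<bar>s M - s N\<bar>) \<longlonglongrightarrow> \<bar>l - s N\<bar>" by (intro tendsto_intros l)
    show "\<forall>\<^sub>F M in sequentially. \<bar>s M - s N\<bar> \<le> 2 * C / real (Suc N)"
      by (rule eventually_sequentiallyI[of N]) (rule diff)
  qed simp
  then show ?thesis unfolding L by (simp add: s_def abs_minus_commute)
qed

text \<open>For each \<open>m\<close> the inner sum over \<open>e \<le> N div m\<close> is replaced
  by \<open>L\<close>. After weighting by \<open>1 / m\<close> this costs at most
  \<open>2 * C / N\<close>, in total \<open>2 * C\<close>; replacing the harmonic sum by the
  logarithm costs \<open>\<bar>L\<bar>\<close>.\<close>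

lemma sum_one_conv_div_asymp:
  fixes \<chi> :: "nat \<Rightarrow> real"
  assumes A: "\<And>N. \<bar>\<Sum>n=1..N. \<chi> n\<bar> \<le> C" and "N > 0"
  defines "L \<equiv> \<Sum>n. \<chi> (Suc n) / real (Suc n)"
  shows "\<bar>(\<Sum>n=1..N. dirichlet_conv (\<lambda>_. 1) \<chi> n / real n) - L * ln (real N)\<bar> \<le> 2 * C + \<bar>L\<bar>"
proof -
  have "C \<ge> 0" using A[of 0] by simp
  have "\<bar>(\<Sum>n=1..N. dirichlet_conv (\<lambda>_. 1) \<chi> n / real n) - L * (\<Sum>m=1..N. 1 / real m)\<bar> =
      \<bar>\<Sum>m=1..N. 1 / real m * ((\<Sum>e=1..N div m. \<chi> e / real e) - L)\<bar>"
    unfolding sum_dirichlet_conv_div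
    by (simp add: sum_subtractf sum_distrib_left algebra_simps sum_divide_distrib)
  also have "\<dots> \<le> (\<Sum>m=1..N. 2 * C / real N)"
  proof (rule order_trans[OF sum_abs], rule sum_mono)
    fix m assume m: "m \<in> {1..N}"
    have "N < m * Suc (N div m)" using m dividend_less_times_div[of m N] by simp
    then have "real N \<le> real m * real (Suc (N div m))" by (metis less_imp_le of_nat_mult of_nat_mono)
    then have "1 / real m * (2 * C / real (Suc (N div m))) \<le> 2 * C / real N"
      using m \<open>C \<ge> 0\<close> \<open>N > 0\<close> by (simp only: times_divide_times_eq mult_1) (intro divide_left_mono; simp)
    moreover have "\<bar>1 / real m * ((\<Sum>e=1..N div m. \<chi> e / real e) - L)\<bar> \<le> 1 / real m * (2 * C / real (Suc (N div m)))"
      unfolding abs_mult L_def using dirichlet_series_at_1_tail[OF A, of "N div m"]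
      by (intro mult_mono) auto
    ultimately show "\<bar>1 / real m * ((\<Sum>e=1..N div m. \<chi> e / real e) - L)\<bar> \<le> 2 * C / real N" by linarith
  qed
  also have "\<dots> = 2 * C" using \<open>N > 0\<close> by simp
  finally have 1: "\<bar>(\<Sum>n=1..N. dirichlet_conv (\<lambda>_. 1) \<chi> n / real n) - L * (\<Sum>m=1..N. 1 / real m)\<bar> \<le> 2 * C" .
  have "\<bar>L * (\<Sum>m=1..N. 1 / real m) - L * ln (real N)\<bar> = \<bar>L\<bar> * \<bar>(\<Sum>m=1..N. 1 / real m) - ln (real N)\<bar>"
    by (simp add: abs_mult flip: right_diff_distrib)
  also have "\<dots> \<le> \<bar>L\<bar> * 1" using ln_harmonic_bound[OF \<open>N > 0\<close>] by (intro mult_left_mono) auto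
  finally show ?thesis using 1 by linarith
qed

text \<open>Each of the \<open>N\<close> inner character sums is at most \<open>C\<close>.\<close>

lemma sum_one_conv_le:
  fixes \<chi> :: "nat \<Rightarrow> real"
  assumes A: "\<And>N. \<bar>\<Sum>n=1..N. \<chi> n\<bar> \<le> C"
  shows "(\<Sum>n=1..N. dirichlet_conv (\<lambda>_. 1) \<chi> n) \<le> C * real N"
proof -
  have "(\<Sum>d=1..N. 1 * (\<Sum>e=1..N div d. \<chi> e)) \<le> (\<Sum>d=1..N. C)"
    using A by (intro sum_mono) (simp add: abs_le_iff)
  then show ?thesis unfolding sum_dirichlet_conv by (simp add: mult.commute)
qed

section \<open>The value of zeta at 2 and two uniformly bounded sums\<close>

lemma zeta_2_sums: "(\<lambda>n. 1 / real (Suc n) ^ 2) sums zeta 2"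
proof -
  have "summable (\<lambda>n. 1 / real (Suc n) ^ 2)"
  proof (rule summable_comparison_test')
    have "(\<lambda>n. 1 / real (Suc n)) \<longlonglongrightarrow> 0"
      using LIMSEQ_inverse_real_of_nat by (simp add: inverse_eq_divide)
    then have "summable (\<lambda>n. 1 / real (Suc n) - 1 / real (Suc (Suc n)))"
      by (rule telescope_summable')
    then show "summable (\<lambda>n. 2 * (1 / real (Suc n) - 1 / real (Suc (Suc n))))"
      by (rule summable_mult)
    show "norm (1 / real (Suc n) ^ 2) \<le> 2 * (1 / real (Suc n) - 1 / real (Suc (Suc n)))" for n
    proof -
      define x where "x = real (Suc n)"
      have "x \<ge> 1" by (simp add: x_def)
      have "1 / x ^ 2 = 2 / (x * (x + x))" by (simp add: power2_eq_square)
      also have "\<dots> \<le> 2 / (x * (x + 1))"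
        using \<open>x \<ge> 1\<close> by (intro divide_left_mono mult_left_mono mult_pos_pos) auto
      also have "\<dots> = 2 * (1 / x - 1 / (x + 1))" using \<open>x \<ge> 1\<close> by (simp add: field_simps)
      finally show ?thesis by (simp add: x_def add.commute)
    qed
  qed
  then show ?thesis by (simp add: zeta_def sums_iff powr_numeral)
qed

lemma zeta_2_pos: "zeta 2 > 0"
  using zeta_2_sums suminf_pos[of "\<lambda>n. 1 / real (Suc n) ^ 2"] by (simp add: sums_iff)

text \<open>The bound 3 - 2 / sqrt K is an equality at K = 1, and its increments dominate the next
  term, as in an integral comparison.\<close>

lemma sum_inverse_sqrt_cubed_le: "(\<Sum>k=1..K. 1 / (real k * sqrt (real k))) \<le> 3"
proof -
  have "(\<Sum>k=1..K. 1 / (real k * sqrt (real k))) \<le> 3 - 2 / sqrt (real K)" if "K > 0"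
    using that
  proof (induction K rule: nat_induct_non_zero)
    case (Suc K)
    define u v where "u = sqrt (real K)" and "v = sqrt (real (Suc K))"
    have uv: "0 < u" "u \<le> v" and sq: "v\<^sup>2 = real (Suc K)" "v\<^sup>2 = u\<^sup>2 + 1"
      using Suc.hyps by (auto simp: u_def v_def)
    have "(v - u) * (v + u) = 1" using sq(2) by (simp add: power2_eq_square algebra_simps)
    then have "u = (v - u) * (v + u) * u" by simp
    also have "\<dots> \<le> (v - u) * (v + v) * v" using uv by (intro mult_mono) auto
    finally have "1 / (v\<^sup>2 * v) \<le> 2 / u - 2 / v"
      using uv by (simp add: field_simps power2_eq_square)
    then show ?case using Suc.IH sq(1) by (simp add: u_def v_def)
  qed simp
  moreover have "2 / sqrt (real K) \<ge> 0" by simp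
  ultimately show ?thesis by (cases "K = 0") (auto intro: order_trans)
qed

text \<open>From ln (2 x^2) = ln 2 + 4 ln (sqrt x) \<le> 4 sqrt x the numerator is at most (a + 4 b)
  sqrt x, which leaves the sum of k^(-3/2).\<close>

lemma sum_ln_div_square_bounded:
  assumes "a \<ge> 0" "b \<ge> 0"
  shows "(\<Sum>k=1..K. (a + b * ln (2 * real k ^ 2)) / real k ^ 2) \<le> 3 * (a + 4 * b)"
proof -
  have "(\<Sum>k=1..K. (a + b * ln (2 * real k ^ 2)) / real k ^ 2) \<le>
      (\<Sum>k=1..K. (a + 4 * b) * (1 / (real k * sqrt (real k))))"
  proof (rule sum_mono)
    fix k assume "k \<in> {1..K}"
    define x where "x = real k"
    have x: "x \<ge> 1" using \<open>k \<in> {1..K}\<close> by (simp add: x_def)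
    have "ln (2 * x ^ 2) = ln 2 + 4 * ln (sqrt x)" using x by (simp add: ln_mult ln_realpow ln_sqrt)
    also have "\<dots> \<le> 1 + 4 * (sqrt x - 1)"
      using ln_le_minus_one[of "sqrt x"] ln_le_minus_one[of 2] x by simp
    also have "\<dots> \<le> 4 * sqrt x" by simp
    finally have "a + b * ln (2 * x ^ 2) \<le> a * sqrt x + b * (4 * sqrt x)"
      using assms x by (intro add_mono mult_left_mono) (auto simp: mult_le_cancel_left1)
    then have "(a + b * ln (2 * x ^ 2)) / x ^ 2 \<le> ((a + 4 * b) * sqrt x) / x ^ 2"
      by (intro divide_right_mono) (simp_all add: algebra_simps)
    also have "sqrt x / x ^ 2 = 1 / (x * sqrt x)"
      using x by (simp add: field_simps power2_eq_square)
    then have "((a + 4 * b) * sqrt x) / x ^ 2 = (a + 4 * b) * (1 / (x * sqrt x))"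
      by (metis times_divide_eq_right)
    finally show "(a + b * ln (2 * real k ^ 2)) / real k ^ 2 \<le> (a + 4 * b) * (1 / (real k * sqrt (real k)))"
      unfolding x_def .
  qed
  also have "\<dots> = (a + 4 * b) * (\<Sum>k=1..K. 1 / (real k * sqrt (real k)))"
    by (rule sum_distrib_left[symmetric])
  also have "\<dots> \<le> (a + 4 * b) * 3"
    using assms sum_inverse_sqrt_cubed_le by (intro mult_left_mono) auto
  finally show ?thesis by simp
qed

section \<open>Removing the square factor from the mean value\<close>

text \<open>Terms with \<open>N < k\<^sup>2\<close> vanish because \<open>R 0 = 0\<close>. The
  cutoff \<open>K\<close> is thus free above \<open>N\<close>, which later allows \<open>K\<close>
  to tend to infinity with \<open>N\<close> fixed.\<close>

lemma sum_square_ind_div: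
  fixes R :: "nat \<Rightarrow> real"
  assumes "R 0 = 0" "N \<le> K"
  shows "(\<Sum>s=1..N. real_of_int (square_ind s) / real s * R (N div s)) = (\<Sum>k=1..K. R (N div k\<^sup>2) / real k ^ 2)"
proof -
  have inj: "inj_on (\<lambda>k. k\<^sup>2) {k::nat. 1 \<le> k \<and> k\<^sup>2 \<le> N}" by (auto simp: inj_on_def)
  have "(\<Sum>s=1..N. real_of_int (square_ind s) / real s * R (N div s)) =
      (\<Sum>s\<in>(\<lambda>k. k\<^sup>2) ` {k. 1 \<le> k \<and> k\<^sup>2 \<le> N}. R (N div s) / real s)"
    by (rule sum.mono_neutral_cong_right)
      (auto simp: square_ind_def is_nth_power_def power2_eq_square)
  also have "\<dots> = (\<Sum>k | 1 \<le> k \<and> k\<^sup>2 \<le> N. R (N div k\<^sup>2) / real k ^ 2)"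
    using inj by (simp add: sum.reindex)
  also have "\<dots> = (\<Sum>k=1..K. R (N div k\<^sup>2) / real k ^ 2)"
  proof (rule sum.mono_neutral_left)
    show "{k. 1 \<le> k \<and> k\<^sup>2 \<le> N} \<subseteq> {1..K}"
      using assms(2) by (auto intro: order_trans[OF self_le_ge2_pow])
       (metis order_trans power2_nat_le_imp_le self_le_power)
    show "\<forall>i\<in>{1..K} - {k. 1 \<le> k \<and> k\<^sup>2 \<le> N}. R (N div i\<^sup>2) / real i ^ 2 = 0"
    proof
      fix i assume "i \<in> {1..K} - {k. 1 \<le> k \<and> k\<^sup>2 \<le> N}"
      then have "N < i\<^sup>2" by auto
      then have "N div i\<^sup>2 = 0" by simp
      then show "R (N div i\<^sup>2) / real i ^ 2 = 0" using assms(1) by simp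
    qed
  qed simp
  finally show ?thesis .
qed

lemma sum_rho_asymp:
  fixes \<chi> \<rho> :: "nat \<Rightarrow> real"
  assumes A: "\<And>N. \<bar>\<Sum>n=1..N. \<chi> n\<bar> \<le> C"
    and nonneg: "\<And>n. \<rho> n \<ge> 0"
    and conv: "\<And>n. n > 0 \<Longrightarrow> dirichlet_conv (\<lambda>n. real_of_int (square_ind n)) \<rho> n = dirichlet_conv (\<lambda>_. 1) \<chi> n"
  defines "L \<equiv> \<Sum>n. \<chi> (Suc n) / real (Suc n)"
  shows "\<And>N. (\<Sum>n=1..N. \<rho> n) \<le> C * real N"
    and "\<exists>B. \<forall>N>0. \<bar>(\<Sum>n=1..N. \<rho> n / real n) - L / zeta 2 * ln (real N)\<bar> \<le> B"
proof -
  define r where "r n = dirichlet_conv (\<lambda>_. 1) \<chi> n" for n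
  define R where "R N = (\<Sum>n=1..N. \<rho> n / real n)" for N
  define S where "S N = (\<Sum>n=1..N. r n / real n)" for N
  have rho_le: "\<rho> n \<le> r n" if "n > 0" for n
  proof -
    \<comment> \<open>All terms of the convolution are nonnegative, and the divisor 1 contributes
      \<open>\<rho> n\<close>.\<close>
    have "(\<Sum>d\<in>{1}. real_of_int (square_ind d) * \<rho> (n div d)) \<le>
        (\<Sum>d | d dvd n. real_of_int (square_ind d) * \<rho> (n div d))"
      using that nonneg by (intro sum_mono2) (auto simp: square_ind_def)
    then have "\<rho> n \<le> dirichlet_conv (\<lambda>n. real_of_int (square_ind n)) \<rho> n"
      by (simp add: dirichlet_conv_def square_ind_def)
    then show ?thesis using conv[OF that] by (simp add: r_def)
  qed
  show "(\<Sum>n=1..N. \<rho> n) \<le> C * real N" for N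
  proof -
    have "(\<Sum>n=1..N. \<rho> n) \<le> (\<Sum>n=1..N. r n)" by (intro sum_mono rho_le) simp
    then show ?thesis using sum_one_conv_le[OF A, of N] by (simp add: r_def)
  qed
  define K1 where "K1 = 2 * C + \<bar>L\<bar>"
  have "C \<ge> 0" using A[of 0] by simp
  then have "K1 \<ge> 0" by (simp add: K1_def)
  have S: "\<bar>S N - L * ln (real N)\<bar> \<le> K1" if "N > 0" for N
    using sum_one_conv_div_asymp[OF A that] by (simp add: S_def r_def K1_def L_def)
  have S_R: "S N = (\<Sum>k=1..K. R (N div k\<^sup>2) / real k ^ 2)" if "N \<le> K" for N K
  proof -
    have "S N = (\<Sum>n=1..N. dirichlet_conv (\<lambda>n. real_of_int (square_ind n)) \<rho> n / real n)"
      unfolding S_def by (intro sum.cong refl) (simp add: conv r_def)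
    also have "\<dots> = (\<Sum>s=1..N. real_of_int (square_ind s) / real s * R (N div s))"
      unfolding sum_dirichlet_conv_div R_def ..
    also have "\<dots> = (\<Sum>k=1..K. R (N div k\<^sup>2) / real k ^ 2)"
      using that by (intro sum_square_ind_div) (simp_all add: R_def)
    finally show ?thesis .
  qed
  have split: "(\<Sum>n=1..N. h n) = (\<Sum>n=1..M. h n) + (\<Sum>n\<in>{M<..N}. h n)" if "M \<le> N" for h :: "nat \<Rightarrow> real" and M N
    using that by (subst sum.union_disjoint[symmetric]) (auto intro!: sum.cong)
  have R_diff: "0 \<le> R N - R M" "R N - R M \<le> S N - S M" if "M \<le> N" for N M
  proof -
    show "0 \<le> R N - R M" using split[OF that] nonneg by (simp add: R_def sum_nonneg)
    have "(\<Sum>n\<in>{M<..N}. \<rho> n / real n) \<le> (\<Sum>n\<in>{M<..N}. r n / real n)"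
      by (intro sum_mono divide_right_mono rho_le) auto
    then show "R N - R M \<le> S N - S M" using split[OF that] by (simp add: R_def S_def)
  qed
  have R_div: "R N - R (N div k\<^sup>2) \<le> 2 * K1 + \<bar>L\<bar> * ln (2 * real k ^ 2)" if "N > 0" "k > 0" for N k
  proof -
    define M where "M = N div k\<^sup>2"
    have "M \<le> N" by (simp add: M_def)
    have Nk: "N < k\<^sup>2 * Suc M" unfolding M_def using that dividend_less_times_div[of "k\<^sup>2" N] by simp
    \<comment> \<open>If \<open>M > 0\<close> then \<open>N \<le> 2 * k\<^sup>2 * M\<close>, so the
      logarithms differ by at most the one shown; if \<open>M = 0\<close> then
      \<open>S M = 0\<close> and \<open>N < k\<^sup>2\<close>.\<close>
    have "S N - S M \<le> 2 * K1 + \<bar>L\<bar> * ln (2 * real k ^ 2)"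
    proof (cases "M = 0")
      case True
      have "N \<le> 2 * k\<^sup>2" using Nk True by simp
      then have "real N \<le> 2 * real k ^ 2" by (metis of_nat_le_iff of_nat_mult of_nat_numeral of_nat_power)
      then have "ln (real N) \<le> ln (2 * real k ^ 2)" using that by simp
      then have "\<bar>L\<bar> * ln (real N) \<le> \<bar>L\<bar> * ln (2 * real k ^ 2)" by (intro mult_left_mono) auto
      moreover have "L * ln (real N) \<le> \<bar>L\<bar> * ln (real N)" using that by (intro mult_right_mono) auto
      moreover have "S M = 0" using True by (simp add: S_def)
      ultimately show ?thesis using S[OF \<open>N > 0\<close>] \<open>K1 \<ge> 0\<close> by linarith
    next
      case False
      have "k\<^sup>2 * Suc M \<le> k\<^sup>2 * (2 * M)" using False by (intro mult_left_mono) auto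
      then have "N \<le> k\<^sup>2 * (2 * M)" using Nk by linarith
      then have "N \<le> 2 * k\<^sup>2 * M" by (simp add: ac_simps)
      then have "real N \<le> 2 * real k ^ 2 * real M" by (metis of_nat_le_iff of_nat_mult of_nat_numeral of_nat_power)
      then have "ln (real N) \<le> ln (2 * real k ^ 2 * real M)" using that False by simp
      also have "\<dots> = ln (2 * real k ^ 2) + ln (real M)" using that False by (simp add: ln_mult)
      finally have "\<bar>L\<bar> * (ln (real N) - ln (real M)) \<le> \<bar>L\<bar> * ln (2 * real k ^ 2)"
        by (intro mult_left_mono) auto
      moreover have "L * (ln (real N) - ln (real M)) \<le> \<bar>L\<bar> * (ln (real N) - ln (real M))"
        using \<open>M \<le> N\<close> False by (intro mult_right_mono) auto
      ultimately show ?thesis using S[OF \<open>N > 0\<close>] S[of M] False by (simp add: algebra_simps abs_le_iff)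
    qed
    then show ?thesis using R_diff(2)[OF \<open>M \<le> N\<close>] by (simp add: M_def)
  qed
  define B where "B = 3 * (2 * K1 + 4 * \<bar>L\<bar>)"
  have B: "(\<Sum>k=1..K. (2 * K1 + \<bar>L\<bar> * ln (2 * real k ^ 2)) / real k ^ 2) \<le> B" for K
    using sum_ln_div_square_bounded[of "2 * K1" "\<bar>L\<bar>"] \<open>K1 \<ge> 0\<close> by (simp add: B_def)
  have ZR: "0 \<le> zeta 2 * R N - S N \<and> zeta 2 * R N - S N \<le> B" if "N > 0" for N
  proof -
    have lim: "(\<lambda>K. (\<Sum>k=1..K. 1 / real k ^ 2) * R N - S N) \<longlonglongrightarrow> zeta 2 * R N - S N"
    proof (intro tendsto_intros)
      show "(\<lambda>K. \<Sum>k=1..K. 1 / real k ^ 2) \<longlonglongrightarrow> zeta 2"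
        using zeta_2_sums by (simp add: sums_def sum.atLeast1_atMost_eq)
    qed
    have bd: "0 \<le> (\<Sum>k=1..K. 1 / real k ^ 2) * R N - S N \<and> (\<Sum>k=1..K. 1 / real k ^ 2) * R N - S N \<le> B"
      if "K \<ge> N" for K
    proof -
      \<comment> \<open>For finite \<open>K\<close> the difference is a sum of nonnegative terms
        bounded uniformly in \<open>K\<close>; letting \<open>K\<close> tend to infinity turns the
        first factor into \<open>zeta 2\<close>.\<close>
      have eq: "(\<Sum>k=1..K. 1 / real k ^ 2) * R N - S N = (\<Sum>k=1..K. (R N - R (N div k\<^sup>2)) / real k ^ 2)"
        unfolding S_R[OF that] by (simp add: sum_distrib_right sum_subtractf diff_divide_distrib)
      have "(\<Sum>k=1..K. (R N - R (N div k\<^sup>2)) / real k ^ 2) \<le> (\<Sum>k=1..K. (2 * K1 + \<bar>L\<bar> * ln (2 * real k ^ 2)) / real k ^ 2)"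
        using R_div[OF \<open>N > 0\<close>] by (intro sum_mono divide_right_mono) auto
      moreover have "0 \<le> (\<Sum>k=1..K. (R N - R (N div k\<^sup>2)) / real k ^ 2)"
        using R_diff(1) by (intro sum_nonneg divide_nonneg_nonneg) auto
      ultimately show ?thesis unfolding eq using B[of K] by linarith
    qed
    have ev: "\<forall>\<^sub>F K in sequentially. 0 \<le> (\<Sum>k=1..K. 1 / real k ^ 2) * R N - S N"
      "\<forall>\<^sub>F K in sequentially. (\<Sum>k=1..K. 1 / real k ^ 2) * R N - S N \<le> B"
      using bd by (auto intro!: eventually_sequentiallyI[of N])
    show ?thesis
      using tendsto_lowerbound[OF lim ev(1)] tendsto_upperbound[OF lim ev(2)] by simp
  qed
  have "\<bar>R N - L / zeta 2 * ln (real N)\<bar> \<le> (B + K1) / zeta 2" if "N > 0" for N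
  proof -
    have "\<bar>zeta 2 * R N - L * ln (real N)\<bar> \<le> B + K1" using ZR[OF that] S[OF that] by linarith
    then have "\<bar>zeta 2 * R N - L * ln (real N)\<bar> / zeta 2 \<le> (B + K1) / zeta 2"
      using zeta_2_pos by (intro divide_right_mono) auto
    moreover have "R N - L / zeta 2 * ln (real N) = (zeta 2 * R N - L * ln (real N)) / zeta 2"
      using zeta_2_pos by (simp add: field_simps)
    ultimately show ?thesis using zeta_2_pos by (simp add: abs_divide)
  qed
  then show "\<exists>B. \<forall>N>0. \<bar>(\<Sum>n=1..N. \<rho> n / real n) - L / zeta 2 * ln (real N)\<bar> \<le> B"
    unfolding R_def by blast
qed

section \<open>Divisors of quadratic values\<close>

lemma card_roots_window:
  assumes "k > 0"
  shows "card {x\<in>{a<..a + k}. k dvd x\<^sup>2 - d} = card (roots_mod d k)"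
proof (rule bij_betw_same_card[of "\<lambda>x. x mod k"], unfold bij_betw_def, intro conjI)
  have "x = y" if "x \<in> {a<..a + k}" "y \<in> {a<..a + k}" "x mod k = y mod k" for x y
  proof -
    have "k dvd x - y" using that(3) by (simp add: mod_eq_dvd_iff)
    moreover have "\<bar>x - y\<bar> < k" using that(1,2) by auto
    ultimately show ?thesis using zdvd_imp_le[of k "\<bar>x - y\<bar>"] by fastforce
  qed
  then show "inj_on (\<lambda>x. x mod k) {x\<in>{a<..a + k}. k dvd x\<^sup>2 - d}"
    unfolding inj_on_def by blast
  show "(\<lambda>x. x mod k) ` {x\<in>{a<..a + k}. k dvd x\<^sup>2 - d} = roots_mod d k"
  proof (intro equalityI subsetI)
    fix y assume "y \<in> (\<lambda>x. x mod k) ` {x\<in>{a<..a + k}. k dvd x\<^sup>2 - d}"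
    then show "y \<in> roots_mod d k" using mod_in_roots_mod_iff[OF assms] by auto
  next
    fix y assume y: "y \<in> roots_mod d k"
    \<comment> \<open>The representative of the class of \<open>y\<close> in the half-open
      window.\<close>
    define x where "x = a + 1 + (y - a - 1) mod k"
    have "x \<in> {a<..a + k}"
      using pos_mod_sign[OF assms, of "y - a - 1"] pos_mod_bound[OF assms, of "y - a - 1"] by (simp add: x_def)
    moreover have "x mod k = y mod k" unfolding x_def by (simp add: mod_simps)
    moreover have "y mod k = y" using y by (simp add: roots_mod_def)
    moreover have "k dvd x\<^sup>2 - d" using y calculation mod_in_roots_mod_iff[OF assms, of x d] by simp
    ultimately show "y \<in> (\<lambda>x. x mod k) ` {x\<in>{a<..a + k}. k dvd x\<^sup>2 - d}" by force
  qed
qed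

text \<open>Each block of length \<open>k\<close> contains \<open>rho d k\<close> solutions, and
  \<open>X\<close> lies between two consecutive multiples of \<open>k\<close>.\<close>

lemma card_roots_interval:
  fixes k X :: nat and b d :: int
  assumes "k > 0"
  defines "W \<equiv> \<lambda>X. card {x\<in>{b<..b + int X}. int k dvd x\<^sup>2 - d}"
  shows "\<bar>real (W X) - real_of_int (rho d k) * real X / real k\<bar> \<le> real_of_int (rho d k)"
    and "X \<le> k \<Longrightarrow> int (W X) \<le> rho d k"
proof -
  have fin: "finite {x\<in>{u<..v}. int k dvd x\<^sup>2 - d}" for u v :: int
    by (rule finite_subset[of _ "{u<..v}"]) auto
  have mult: "int (W (j * k)) = int j * rho d k" for j
  proof (induction j)
    case (Suc j)
    have "{x\<in>{b<..b + int (Suc j * k)}. int k dvd x\<^sup>2 - d} =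
        {x\<in>{b<..b + int (j * k)}. int k dvd x\<^sup>2 - d} \<union>
        {x\<in>{b + int (j * k)<..b + int (j * k) + int k}. int k dvd x\<^sup>2 - d}"
      by (auto simp: algebra_simps) (smt (verit) mult_nonneg_nonneg of_nat_0_le_iff)+
    then have "W (Suc j * k) = W (j * k) +
        card {x\<in>{b + int (j * k)<..b + int (j * k) + int k}. int k dvd x\<^sup>2 - d}"
      unfolding W_def
    proof (simp only:, intro card_Un_disjoint fin)
      have "{b<..b + int (j * k)} \<inter> {b + int (j * k)<..b + int (j * k) + int k} = {}" by auto
      then show "{x\<in>{b<..b + int (j * k)}. int k dvd x\<^sup>2 - d} \<inter>
          {x\<in>{b + int (j * k)<..b + int (j * k) + int k}. int k dvd x\<^sup>2 - d} = {}" by blast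
    qed
    also have "card {x\<in>{b + int (j * k)<..b + int (j * k) + int k}. int k dvd x\<^sup>2 - d} = card (roots_mod d (int k))"
      using assms(1) by (intro card_roots_window) simp
    finally show ?case using Suc.IH by (simp add: rho_def algebra_simps)
  next
    case 0
    have "{x\<in>{b<..b + int (0 * k)}. int k dvd x\<^sup>2 - d} = {}" by auto
    then have "W (0 * k) = 0" unfolding W_def by (simp only: card.empty)
    then show ?case by simp
  qed
  have mono: "W X \<le> W Y" if "X \<le> Y" for X Y
    unfolding W_def using that by (intro card_mono fin) auto
  show "int (W X) \<le> rho d k" if "X \<le> k"
    using mono[OF that] mult[of 1] by simp
  define j where "j = X div k"
  define r where "r = real_of_int (rho d k)"
  have "r \<ge> 0" by (simp add: r_def rho_def)
  have multr: "real (W (j * k)) = real j * r" for j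
    using mult[of j] unfolding r_def by (metis of_int_mult of_int_of_nat_eq)
  have "j * k \<le> X" "X < Suc j * k"
    using dividend_less_div_times[OF assms(1), of X] by (simp_all add: j_def add.commute)
  then have w: "W (j * k) \<le> W X" "W X \<le> W (Suc j * k)" by (intro mono; simp)+
  have "real j * real k \<le> real X" "real X \<le> (real j + 1) * real k"
    using \<open>j * k \<le> X\<close> \<open>X < Suc j * k\<close> by (metis of_nat_le_iff of_nat_mult, metis less_imp_le of_nat_Suc of_nat_le_iff of_nat_mult add.commute)
  then have "real j \<le> real X / real k" "real X / real k \<le> real j + 1"
    using assms(1) by (simp_all add: pos_le_divide_eq pos_divide_le_eq)
  then have "r * real j \<le> r * (real X / real k)" "r * (real X / real k) \<le> r * (real j + 1)"
    using \<open>r \<ge> 0\<close> by (intro mult_left_mono; simp)+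
  moreover have "real j * r \<le> real (W X)" "real (W X) \<le> (real j + 1) * r"
    using w multr[of j] multr[of "Suc j"] by (simp_all add: algebra_simps flip: of_nat_le_iff)
  ultimately show "\<bar>real (W X) - real_of_int (rho d k) * real X / real k\<bar> \<le> real_of_int (rho d k)"
    unfolding r_def[symmetric] by (simp add: algebra_simps abs_le_iff)
qed

section \<open>Pairing divisors around the square root\<close>

text \<open>With M = \<open>\<bar>m\<bar>\<close> the hypothesis gives (M - 1) M < g < (M + 1)^2. So
  \<open>e \<mapsto> g div e\<close> sends divisors above M to divisors up to M, and divisors below
  M to divisors above M; only M itself can remain unpaired.\<close>

lemma tau_square_minus_bounds:
  fixes m d :: int
  assumes "\<bar>d\<bar> < \<bar>m\<bar>"
  defines "g \<equiv> m\<^sup>2 - d"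
  defines "c \<equiv> card {e\<in>{1..\<bar>m\<bar>}. e dvd g}"
  shows "tau g \<le> 2 * c" "2 * c \<le> tau g + 1"
proof -
  define M where "M = \<bar>m\<bar>"
  have M: "\<bar>d\<bar> < M" "M > 0" "g = M * M - d" using assms by (auto simp: M_def g_def power2_eq_square)
  have "M * 1 \<le> M * M" using M(2) by (intro mult_left_mono) auto
  then have "g > 0" using M by linarith
  define Lo Hi where "Lo = {e\<in>{1..M}. e dvd g}" and "Hi = {e. e > M \<and> e dvd g}"
  have fin: "finite {e. e > 0 \<and> e dvd g}"
    by (rule finite_subset[of _ "{0..g}"]) (use \<open>g > 0\<close> zdvd_imp_le in auto)
  have part: "{e. e > 0 \<and> e dvd g} = Lo \<union> Hi" "Lo \<inter> Hi = {}" using M(2) by (auto simp: Lo_def Hi_def)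
  then have finite: "finite Lo" "finite Hi" using fin by auto
  have tau: "tau g = card Lo + card Hi"
    unfolding tau_def part(1) by (rule card_Un_disjoint[OF finite part(2)])
  have pos: "e > 0 \<and> e * (g div e) = g \<and> g div e > 0" if "e \<in> Lo \<union> Hi" for e
  proof -
    have e: "e > 0" "e dvd g" using that part(1) by auto
    then have "e * (g div e) = g" by simp
    then show ?thesis using e \<open>g > 0\<close> by (metis zero_less_mult_pos)
  qed
  have inj: "inj_on (\<lambda>e. g div e) (Lo \<union> Hi)"
    by (rule inj_onI) (metis pos less_irrefl mult_cancel_right)
  have "(\<lambda>e. g div e) ` Hi \<subseteq> Lo"
  proof
    fix y assume "y \<in> (\<lambda>e. g div e) ` Hi"
    then obtain e where e: "e \<in> Hi" "y = g div e" by auto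
    then have y: "e * y = g" "y > 0" "e \<ge> M + 1" using pos[of e] by (auto simp: Hi_def)
    have "y \<le> M"
    proof (rule ccontr)
      assume "\<not> y \<le> M"
      then have "(M + 1) * (M + 1) \<le> e * y" using y M(2) by (intro mult_mono) auto
      then show False using y M by (simp add: algebra_simps)
    qed
    moreover have "y dvd g" using y(1) by (metis dvd_triv_right)
    ultimately show "y \<in> Lo" using y by (simp add: Lo_def)
  qed
  then have "card Hi \<le> card Lo"
    using inj finite by (intro card_inj_on_le[of "\<lambda>e. g div e"]) (auto intro: inj_on_subset)
  have "(\<lambda>e. g div e) ` (Lo - {M}) \<subseteq> Hi"
  proof
    fix y assume "y \<in> (\<lambda>e. g div e) ` (Lo - {M})"
    then obtain e where e: "e \<in> Lo" "e \<noteq> M" "y = g div e" by auto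
    then have y: "e * y = g" "y > 0" "e \<le> M - 1" "e > 0" using pos[of e] by (auto simp: Lo_def)
    have "y > M"
    proof (rule ccontr)
      assume "\<not> y > M"
      then have "e * y \<le> (M - 1) * M" using y M(2) by (intro mult_mono) auto
      then show False using y M by (simp add: algebra_simps)
    qed
    moreover have "y dvd g" using y(1) by (metis dvd_triv_right)
    ultimately show "y \<in> Hi" by (simp add: Hi_def)
  qed
  then have "card (Lo - {M}) \<le> card Hi"
    using inj finite by (intro card_inj_on_le[of "\<lambda>e. g div e"]) (auto intro: inj_on_subset)
  moreover have "card Lo \<le> card (Lo - {M}) + 1"
    using card_Suc_Diff1[of Lo M] finite by (cases "M \<in> Lo") auto
  moreover have "c = card Lo" by (simp add: c_def Lo_def M_def)
  ultimately show "tau g \<le> 2 * c" "2 * c \<le> tau g + 1" using tau \<open>card Hi \<le> card Lo\<close> by linarith+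
qed

text \<open>Used to move the cutoff from \<open>\<bar>n + b\<bar>\<close> to \<open>n\<close> at
  bounded cost.\<close>

lemma card_divisors_upto_shift:
  fixes g u v :: int
  shows "int (card {e\<in>{1..u}. e dvd g}) \<le> int (card {e\<in>{1..v}. e dvd g}) + \<bar>u - v\<bar>"
proof -
  have "card {e\<in>{1..u}. e dvd g} \<le> card ({e\<in>{1..v}. e dvd g} \<union> {v<..v + \<bar>u - v\<bar>})"
  proof (rule card_mono)
    show "finite ({e\<in>{1..v}. e dvd g} \<union> {v<..v + \<bar>u - v\<bar>})"
      by (rule finite_subset[of _ "{1..v} \<union> {v<..v + \<bar>u - v\<bar>}"]) auto
  qed auto
  also have "\<dots> \<le> card {e\<in>{1..v}. e dvd g} + card {v<..v + \<bar>u - v\<bar>}" by (rule card_Un_le)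
  finally show ?thesis by simp
qed

lemma tau_quadratic_approx:
  fixes b d :: int
  shows "\<exists>C. \<forall>n\<ge>1. \<bar>real (tau ((int n + b)\<^sup>2 - d)) -
    2 * real (card {e\<in>{1..int n}. e dvd (int n + b)\<^sup>2 - d})\<bar> \<le> C"
proof -
  define D where "D n = \<bar>real (tau ((int n + b)\<^sup>2 - d)) -
    2 * real (card {e\<in>{1..int n}. e dvd (int n + b)\<^sup>2 - d})\<bar>" for n
  define B where "B = nat (\<bar>b\<bar> + \<bar>d\<bar>)"
  \<comment> \<open>Beyond \<open>B\<close> the pairing costs 1 and the moved cutoff costs twice
    \<open>\<bar>b\<bar>\<close>. The finitely many smaller \<open>n\<close>, including any at which
    the quadratic is zero or negative, are absorbed into the sum.\<close>
  have "D n \<le> 1 + 2 * real_of_int \<bar>b\<bar> + (\<Sum>n\<le>B. D n)" for n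
  proof (cases "n \<le> B")
    case True
    have "D n \<le> (\<Sum>n\<le>B. D n)" using True by (intro member_le_sum) (auto simp: D_def)
    then show ?thesis by simp
  next
    case False
    then have n: "int n > \<bar>b\<bar> + \<bar>d\<bar>" by (simp add: B_def)
    then have "\<bar>d\<bar> < \<bar>int n + b\<bar>" by linarith
    note t = tau_square_minus_bounds[OF this]
    have "\<bar>int n - \<bar>int n + b\<bar>\<bar> = \<bar>b\<bar>" "\<bar>\<bar>int n + b\<bar> - int n\<bar> = \<bar>b\<bar>" using n by linarith+
    then have "\<bar>int (tau ((int n + b)\<^sup>2 - d)) - 2 * int (card {e\<in>{1..int n}. e dvd (int n + b)\<^sup>2 - d})\<bar> \<le> 1 + 2 * \<bar>b\<bar>"
      using card_divisors_upto_shift[of "int n" "(int n + b)\<^sup>2 - d" "\<bar>int n + b\<bar>"]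
        card_divisors_upto_shift[of "\<bar>int n + b\<bar>" "(int n + b)\<^sup>2 - d" "int n"] t
      by linarith
    then have "D n \<le> 1 + 2 * real_of_int \<bar>b\<bar>" unfolding D_def by linarith
    moreover have "0 \<le> (\<Sum>n\<le>B. D n)" by (intro sum_nonneg) (simp add: D_def)
    ultimately show ?thesis by linarith
  qed
  then show ?thesis unfolding D_def by blast
qed

section \<open>Interchange of summation and assembly of the asymptotics\<close>

lemma sum_divisor_count_swap:
  fixes g :: "nat \<Rightarrow> int"
  shows "(\<Sum>n=1..N. card {e\<in>{1..int n}. e dvd g n}) = (\<Sum>k=1..N. card {n\<in>{k..N}. int k dvd g n})"
proof -
  have "card {e\<in>{1..int n}. e dvd g n} = (\<Sum>k=1..N. of_bool (k \<le> n \<and> int k dvd g n))" if "n \<in> {1..N}" for n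
  proof -
    have "{e\<in>{1..int n}. e dvd g n} = int ` {k\<in>{1..N}. k \<le> n \<and> int k dvd g n}"
    proof (intro equalityI subsetI)
      fix e assume "e \<in> {e\<in>{1..int n}. e dvd g n}"
      then show "e \<in> int ` {k\<in>{1..N}. k \<le> n \<and> int k dvd g n}"
        using that by (intro image_eqI[of _ _ "nat e"]) auto
    qed auto
    then have "card {e\<in>{1..int n}. e dvd g n} = card {k\<in>{1..N}. k \<le> n \<and> int k dvd g n}"
      by (simp add: card_image)
    then show ?thesis by (simp add: Int_def)
  qed
  then have "(\<Sum>n=1..N. card {e\<in>{1..int n}. e dvd g n}) =
      (\<Sum>n=1..N. \<Sum>k=1..N. of_bool (k \<le> n \<and> int k dvd g n))" by simp
  also have "\<dots> = (\<Sum>k=1..N. \<Sum>n=1..N. of_bool (k \<le> n \<and> int k dvd g n))" by (rule sum.swap)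
  also have "\<dots> = (\<Sum>k=1..N. card {n\<in>{k..N}. int k dvd g n})"
  proof (intro sum.cong refl)
    fix k assume "k \<in> {1..N}"
    then have "{1..N} \<inter> {n. k \<le> n \<and> int k dvd g n} = {n\<in>{k..N}. int k dvd g n}" by auto
    then show "(\<Sum>n=1..N. of_bool (k \<le> n \<and> int k dvd g n)) = card {n\<in>{k..N}. int k dvd g n}" by simp
  qed
  finally show ?thesis .
qed

text \<open>The count over \<open>k..N\<close> is that over \<open>1..N\<close> minus that over
  \<open>1..k - 1\<close>. The latter range is shorter than one period, so each of the two errors is
  at most \<open>rho d k\<close>.\<close>

lemma card_multiples_quadratic:
  fixes b d :: int
  assumes "1 \<le> k" "k \<le> N"
  shows "\<bar>real (card {n\<in>{k..N}. int k dvd (int n + b)\<^sup>2 - d}) - real_of_int (rho d k) * real N / real k\<bar>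
    \<le> 2 * real_of_int (rho d k)"
proof -
  define W where "W X = card {x\<in>{b<..b + int X}. int k dvd x\<^sup>2 - d}" for X
  have bij: "card {n\<in>{1..X}. int k dvd (int n + b)\<^sup>2 - d} = W X" for X
    unfolding W_def
    by (rule bij_betw_same_card[of "\<lambda>n. int n + b"], rule bij_betw_byWitness[of _ "\<lambda>x. nat (x - b)"]) auto
  have "{n\<in>{1..N}. int k dvd (int n + b)\<^sup>2 - d} =
      {n\<in>{1..k - 1}. int k dvd (int n + b)\<^sup>2 - d} \<union> {n\<in>{k..N}. int k dvd (int n + b)\<^sup>2 - d}"
    using assms by auto
  then have "card {n\<in>{1..N}. int k dvd (int n + b)\<^sup>2 - d} =
      card {n\<in>{1..k - 1}. int k dvd (int n + b)\<^sup>2 - d} + card {n\<in>{k..N}. int k dvd (int n + b)\<^sup>2 - d}"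
    using assms by (simp only:) (intro card_Un_disjoint; auto)
  then have split: "W N = W (k - 1) + card {n\<in>{k..N}. int k dvd (int n + b)\<^sup>2 - d}" using bij by simp
  have "\<bar>real (W N) - real_of_int (rho d k) * real N / real k\<bar> \<le> real_of_int (rho d k)"
    unfolding W_def using assms by (intro card_roots_interval(1)) simp
  moreover have "int (W (k - 1)) \<le> rho d k"
    unfolding W_def using assms by (intro card_roots_interval(2)) simp_all
  then have "real (W (k - 1)) \<le> real_of_int (rho d k)" by linarith
  ultimately show ?thesis using split by linarith
qed

theorem theorem1:
  fixes b c \<delta> :: int and \<chi> :: "nat \<Rightarrow> int"
  assumes "\<delta> = b\<^sup>2 - c"
    and "\<delta> \<noteq> 0"
    and "squarefree \<delta>"
    and "\<not> [\<delta> = 1] (mod 4)"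
    and "\<And>n. \<chi> n = kronecker (4 * \<delta>) (int n)"
  shows "(\<lambda>N::nat. real (\<Sum>n=1..N. tau ((int n)\<^sup>2 + 2 * b * int n + c))
            - 2 / zeta 2 * L_one \<chi> * real N * ln (real N)) \<in> O(\<lambda>N. real N)"
proof -
  define f where "f n = (int n + b)\<^sup>2 - \<delta>" for n
  have f: "(int n)\<^sup>2 + 2 * b * int n + c = f n" for n
    using assms(1) by (simp add: f_def power2_eq_square algebra_simps)
  define \<rho> where "\<rho> n = real_of_int (rho \<delta> n)" for n
  \<comment> \<open>The congruence condition excludes the principal character.\<close>
  have "\<delta> \<noteq> 1" using assms(4) by auto
  then obtain C0 where C0: "\<And>N. \<bar>\<Sum>n<N. kronecker (4 * \<delta>) (int n)\<bar> \<le> C0"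
    using kronecker_partial_sums_bounded[OF assms(3)] by blast
  \<comment> \<open>\<open>C0\<close> bounds sums starting at 0; the added term pays for starting at
    1.\<close>
  define C where "C = real_of_int (C0 + \<bar>\<chi> 0\<bar>)"
  have partial: "\<bar>\<Sum>n=1..N. real_of_int (\<chi> n)\<bar> \<le> C" for N
  proof -
    have "(\<Sum>n<Suc N. \<chi> n) = \<chi> 0 + (\<Sum>n=1..N. \<chi> n)"
      by (simp add: lessThan_Suc_atMost sum.atLeast1_atMost_eq sum.atMost_shift)
    then have "\<bar>\<Sum>n=1..N. \<chi> n\<bar> \<le> C0 + \<bar>\<chi> 0\<bar>" using C0[of "Suc N"] by (simp add: assms(5))
    then show ?thesis unfolding C_def by (simp flip: of_int_sum of_int_abs)
  qed
  have nonneg: "\<rho> n \<ge> 0" for n by (simp add: \<rho>_def rho_def)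
  have conv: "dirichlet_conv (\<lambda>n. real_of_int (square_ind n)) \<rho> n =
      dirichlet_conv (\<lambda>_. 1) (\<lambda>n. real_of_int (\<chi> n)) n" if "n > 0" for n
  proof -
    have "dirichlet_conv square_ind (rho \<delta>) n = dirichlet_conv (\<lambda>_. 1) \<chi> n"
      using rho_conv_square_ind[OF assms(3,4) that] dirichlet_conv_commute[OF that, of "rho \<delta>" square_ind]
      unfolding assms(5)[abs_def] by simp
    then have "real_of_int (dirichlet_conv square_ind (rho \<delta>) n) = real_of_int (dirichlet_conv (\<lambda>_. 1) \<chi> n)"
      by simp
    then show ?thesis by (simp add: dirichlet_conv_def \<rho>_def)
  qed
  note asymp = sum_rho_asymp[of "\<lambda>n. real_of_int (\<chi> n)" C \<rho>, OF partial nonneg conv]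
  define L where "L = L_one \<chi>"
  obtain B where B: "\<And>N. N > 0 \<Longrightarrow> \<bar>(\<Sum>n=1..N. \<rho> n / real n) - L / zeta 2 * ln (real N)\<bar> \<le> B"
    using asymp(2) unfolding L_def L_one_def by blast
  obtain T where T: "\<And>n. n \<ge> 1 \<Longrightarrow> \<bar>real (tau (f n)) - 2 * real (card {e\<in>{1..int n}. e dvd f n})\<bar> \<le> T"
    using tau_quadratic_approx[of b \<delta>] unfolding f_def by blast
  \<comment> \<open>\<open>T\<close> comes from halving the divisors, \<open>4 * C\<close> from
    twice the residue counting error \<open>2 * C\<close>, and \<open>2 * B\<close> from twice the
    error in the sum of \<open>\<rho> n / n\<close>.\<close>
  have main: "\<bar>real (\<Sum>n=1..N. tau (f n)) - 2 / zeta 2 * L * real N * ln (real N)\<bar> \<le> (T + 4 * C + 2 * B) * real N"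
    if "N > 0" for N
  proof -
    have "\<bar>\<Sum>n=1..N. real (tau (f n)) - 2 * real (card {e\<in>{1..int n}. e dvd f n})\<bar> \<le> (\<Sum>n=1..N. T)"
      by (rule order_trans[OF sum_abs], rule sum_mono, rule T) simp
    then have 1: "\<bar>real (\<Sum>n=1..N. tau (f n)) - 2 * real (\<Sum>n=1..N. card {e\<in>{1..int n}. e dvd f n})\<bar> \<le> T * real N"
      by (simp add: sum_subtractf sum_distrib_left mult.commute)
    have "\<bar>\<Sum>k=1..N. real (card {n\<in>{k..N}. int k dvd f n}) - \<rho> k * real N / real k\<bar> \<le> (\<Sum>k=1..N. 2 * \<rho> k)"
      unfolding f_def \<rho>_def
      by (rule order_trans[OF sum_abs], rule sum_mono, rule card_multiples_quadratic) auto
    also have "\<dots> \<le> 2 * (C * real N)" using asymp(1)[of N] by (simp flip: sum_distrib_left)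
    finally have "\<bar>real (\<Sum>k=1..N. card {n\<in>{k..N}. int k dvd f n}) - real N * (\<Sum>k=1..N. \<rho> k / real k)\<bar> \<le> 2 * (C * real N)"
      by (simp add: sum_subtractf sum_distrib_left mult.commute)
    then have 2: "\<bar>real (\<Sum>n=1..N. card {e\<in>{1..int n}. e dvd f n}) - real N * (\<Sum>k=1..N. \<rho> k / real k)\<bar> \<le> 2 * (C * real N)"
      unfolding sum_divisor_count_swap .
    have "\<bar>real N * ((\<Sum>n=1..N. \<rho> n / real n) - L / zeta 2 * ln (real N))\<bar> \<le> real N * B"
      unfolding abs_mult using B[OF that] by (intro mult_mono) auto
    then have 3: "\<bar>real N * (\<Sum>n=1..N. \<rho> n / real n) - L / zeta 2 * real N * ln (real N)\<bar> \<le> B * real N"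
      by (simp add: algebra_simps)
    have "2 / zeta 2 * L * real N * ln (real N) = 2 * (L / zeta 2 * real N * ln (real N))" by simp
    then show ?thesis using 1 2 3 unfolding distrib_right by linarith
  qed
  have "(\<lambda>N. real (\<Sum>n=1..N. tau (f n)) - 2 / zeta 2 * L * real N * ln (real N)) \<in> O(\<lambda>N. real N)"
  proof (rule bigoI)
    show "\<forall>\<^sub>F N in at_top. norm (real (\<Sum>n=1..N. tau (f n)) - 2 / zeta 2 * L * real N * ln (real N))
        \<le> (T + 4 * C + 2 * B) * norm (real N)"
      using eventually_gt_at_top[of "0::nat"] by eventually_elim (use main in simp)
  qed
  then show ?thesis unfolding f L_def .
qed

end
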